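(* Let $p\in[1,2)$, $\varepsilon\in[0,1]$, $D>0$, $B>0$. There exist absolute constants $c_0,c_1>0$ (one can take $c_0=\frac{1}{2e(e-1)^2}$ and $c_1=\frac{1}{36(e-1)\sqrt{2e}}$) such that, for all $T\ge c_0\frac{d}{\varepsilon^2}$, \[ \sup_{\mathcal{X}\in\mathbb{X}_p(D)}\mathcal{E}^*(\mathcal{X},\mathcal{O}_{\mathtt{c},p},T,\mathcal{W}_{\mathtt{priv},\varepsilon})\ \ge\ \frac{c_1DB}{\sqrt T}\cdot\sqrt{\frac{d}{\varepsilon^2}}. \]
   Context: Setting (first-order optimization under information constraints). Fix $d\ge1$, $\mathcal{X}\subseteq\mathbb{R}^d$, and a set $\mathcal{W}$ of channels (randomized maps/Markov kernels) with input space $\mathbb{R}^d$. An algorithm $\pi$ with $T$ queries interacts with an oracle $O$ for a function $f:\mathcal{X}\to\mathbb{R}$: at step $t=1,\dots,T$ it queries $x_t\in\mathcal{X}$; the oracle returns a random vector $\hat g(x_t)$ with $\mathbb{E}[\hat g(x_t)\mid x_t]\in\partial f(x_t)$; $\hat g(x_t)$ is passed through a channel $W_t\in\mathcal{W}$ and the algorithm only observes the output $Y_t\sim W_t(\cdot\mid\hat g(x_t))$; $x_{t+1}$ (and the final output $x_T$) is a possibly randomized function of $Y_1,\dots,Y_t$. An adaptive channel selection strategy chooses each $W_t$ as a function of $Y_1,\dots,Y_{t-1}$; a nonadaptive strategy fixes $W_1,\dots,W_T$ before the start. For a class $\mathcal{O}$ of function–oracle pairs, the adaptive minmax error is $\mathcal{E}^*(\mathcal{X},\mathcal{O},T,\mathcal{W})=\inf_{\pi}\inf_{S\text{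 adaptive}}\sup_{(f,O)\in\mathcal{O}}\mathbb{E}[f(x_T)-\min_{x\in\mathcal{X}}f(x)]$, the infimum being over algorithms with $T$ queries and adaptive channel selection strategies using channels from $\mathcal{W}$. For $p\in[1,\infty]$ let $q=p/(p-1)$ be its Hölder conjugate; $\mathcal{O}_{\mathtt{c},p}$ is the set of pairs $(f,O)$ with $f$ convex on $\mathcal{X}$, oracle outputs satisfying $\mathbb{E}[\hat g(x)\mid x]\in\partial f(x)$ and $\Pr(\|\hat g(x)\|_q^2\le B^2\mid x)=1$ for all $x\in\mathcal{X}$. $\mathbb{X}_p(D)=\{\mathcal{X}\subseteq\mathbb{R}^d:\max_{x,y\in\mathcal{X}}\|x-y\|_p\le D\}$. $\mathcal{W}_{\mathtt{priv},\varepsilon}$ is the set of all $\varepsilon$-locally differentially private channels $W:\mathbb{R}^d\to\mathbb{R}^d$, i.e. $W(Y\in S\mid X=x)\le e^{\varepsilon}W(Y\in S\mid X=x')$ for all $x,x'\in\mathbb{R}^d$ and all Borel $S\subseteq\mathbb{R}^d$. *)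

theory Defs
  imports "HOL-Probability.Probability"
begin

definition lpnorm :: "ereal \<Rightarrow> 'a::euclidean_space \<Rightarrow> real" where
  "lpnorm p x = (if p = \<infinity> then Max ((\<lambda>b. \<bar>x \<bullet> b\<bar>) ` Basis)
     else (\<Sum>b\<in>Basis. \<bar>x \<bullet> b\<bar> powr real_of_ereal p) powr (1 / real_of_ereal p))"

definition hconj :: "real \<Rightarrow> ereal" where
  "hconj p = (if p = 1 then \<infinity> else ereal (p / (p - 1)))"

definition Xsets :: "real \<Rightarrow> real \<Rightarrow> 'a::euclidean_space set set" where
  "Xsets p D = {X. X \<noteq> {} \<and> (\<forall>x\<in>X. \<forall>y\<in>X. lpnorm (ereal p) (x - y) \<le> D)}"

definition subgrad :: "('a::euclidean_space \<Rightarrow> real) \<Rightarrow> 'a set \<Rightarrow> 'a \<Rightarrow> 'a set" where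
  "subgrad f X x = {g. \<forall>y\<in>X. f x + g \<bullet> (y - x) \<le> f y}"

definition ldp_channel :: "real \<Rightarrow> ('a::euclidean_space \<Rightarrow> 'a measure) \<Rightarrow> bool" where
  "ldp_channel \<epsilon> W \<longleftrightarrow> (\<forall>g. W g \<in> space (prob_algebra borel)) \<and>
     (\<forall>g g' S. S \<in> sets borel \<longrightarrow> measure (W g) S \<le> exp \<epsilon> * measure (W g') S)"

definition oracle_class :: "real \<Rightarrow> real \<Rightarrow> 'a::euclidean_space set
    \<Rightarrow> (('a \<Rightarrow> real) \<times> ('a \<Rightarrow> 'a measure)) set" where
  "oracle_class p B X = {(f, Orc). convex_on X f \<and> f \<in> borel_measurable borel \<and>
     Orc \<in> borel \<rightarrow>\<^sub>M prob_algebra borel \<and>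
     (\<forall>x\<in>X. integrable (Orc x) (\<lambda>g. g) \<and> (\<integral>g. g \<partial>Orc x) \<in> subgrad f X x \<and>
        (AE g in Orc x. (lpnorm (hconj p) g)\<^sup>2 \<le> B\<^sup>2))}"

text \<open>Histories: h i = (x_{i+1}, Y_{i+1}) for the already performed steps i.\<close>
definition HM :: "(nat \<Rightarrow> 'a::euclidean_space \<times> 'a) measure" where
  "HM = Pi\<^sub>M UNIV (\<lambda>_. borel)"

text \<open>Joint law of the history after t rounds. Q t h: (randomized) query at round t
  given the history; S t ys: channel chosen at round t from the past outputs ys;
  O: oracle kernel.\<close>
primrec run :: "(nat \<Rightarrow> (nat \<Rightarrow> 'a::euclidean_space \<times> 'a) \<Rightarrow> 'a measure)
    \<Rightarrow> (nat \<Rightarrow> (nat \<Rightarrow> 'a) \<Rightarrow> 'a \<Rightarrow> 'a measure) \<Rightarrow> ('a \<Rightarrow> 'a measure) \<Rightarrow> nat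
    \<Rightarrow> (nat \<Rightarrow> 'a \<times> 'a) measure" where
  "run Q S Orc 0 = return HM (\<lambda>_. (0, 0))"
| "run Q S Orc (Suc t) = run Q S Orc t \<bind> (\<lambda>h. Q t h \<bind> (\<lambda>x. Orc x \<bind> (\<lambda>g.
      S t (\<lambda>i. snd (h i)) g \<bind> (\<lambda>y. return HM (h(t := (x, y)))))))"

definition valid_alg :: "'a::euclidean_space set \<Rightarrow>
    ((nat \<Rightarrow> (nat \<Rightarrow> 'a \<times> 'a) \<Rightarrow> 'a measure) \<times> ((nat \<Rightarrow> 'a \<times> 'a) \<Rightarrow> 'a measure)) set" where
  "valid_alg X = {(Q, Out). (\<forall>t. Q t \<in> HM \<rightarrow>\<^sub>M prob_algebra borel) \<and>
     Out \<in> HM \<rightarrow>\<^sub>M prob_algebra borel \<and>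
     (\<forall>t h. AE x in Q t h. x \<in> X) \<and> (\<forall>h. AE x in Out h. x \<in> X)}"

definition valid_strategy :: "real \<Rightarrow> (nat \<Rightarrow> (nat \<Rightarrow> 'a::euclidean_space) \<Rightarrow> 'a \<Rightarrow> 'a measure) set" where
  "valid_strategy \<epsilon> = {S. (\<forall>t ys. ldp_channel \<epsilon> (S t ys)) \<and>
     (\<forall>t. (\<lambda>(h, g). S t (\<lambda>i. snd (h i)) g) \<in> (HM \<Otimes>\<^sub>M borel) \<rightarrow>\<^sub>M prob_algebra borel)}"

definition opt_error :: "('a::euclidean_space \<Rightarrow> real) \<Rightarrow> 'a set \<Rightarrow> ('a \<Rightarrow> 'a measure)
    \<Rightarrow> (nat \<Rightarrow> (nat \<Rightarrow> 'a \<times> 'a) \<Rightarrow> 'a measure) \<Rightarrow> ((nat \<Rightarrow> 'a \<times> 'a) \<Rightarrow> 'a measure)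
    \<Rightarrow> (nat \<Rightarrow> (nat \<Rightarrow> 'a) \<Rightarrow> 'a \<Rightarrow> 'a measure) \<Rightarrow> nat \<Rightarrow> ennreal" where
  "opt_error f X Orc Q Out S T =
     (\<integral>\<^sup>+ x. ennreal (f x - Inf (f ` X)) \<partial>(run Q S Orc T \<bind> Out))"

definition minmax_err :: "real \<Rightarrow> real \<Rightarrow> real \<Rightarrow> 'a::euclidean_space set \<Rightarrow> nat \<Rightarrow> ennreal" where
  "minmax_err p B \<epsilon> X T =
     (INF QO \<in> valid_alg X. INF S \<in> valid_strategy \<epsilon>.
        SUP fO \<in> oracle_class p B X. opt_error (fst fO) X (snd fO) (fst QO) (snd QO) S T)"

end

theory Submission
  imports Defs
begin

text \<open>
  On the cube \<open>[-r, r]\<^sup>d\<close> with \<open>\<ell>\<^sub>p\<close>-diameter \<open>D\<close> take the linear functions whose gradients are the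
  \<open>2\<^sup>d\<close> vectors \<open>\<plusminus>\<theta>\<beta>\<close>, with the oracle that returns a random vertex of \<open>{-\<beta>, \<beta>}\<^sup>d\<close> whose independent
  coordinates have bias \<open>\<theta>\<close> in the direction of the gradient. Optimising such a function amounts to
  learning its sign pattern \<open>V\<close>. Flipping the sign \<open>i\<close> of \<open>V\<close> changes the law of the oracle by a score
  function of coordinate \<open>i\<close> alone. The scores are orthogonal, so Bessel's inequality bounds the sum over
  \<open>i\<close> of the chi-square divergences seen through one locally private channel by about
  \<open>4 \<theta>\<^sup>2 (e\<^sup>\<epsilon> - 1)\<^sup>2\<close>, without a factor \<open>d\<close>. By the chain rule the relative entropies over \<open>T\<close> rounds
  sum to at most \<open>T\<close> times this, which is a small multiple of \<open>d\<close> when \<open>\<theta>\<^sup>2\<close> is of order \<open>d / (T \<epsilon>\<^sup>2)\<close>.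
  Averaging over all \<open>V\<close>, some pattern is then learned only poorly.
\<close>

subsection \<open>Sums of relative entropies\<close>

text \<open>By the Donsker--Varadhan formula this says that the sum over \<open>i \<in> I\<close> of the relative entropies of
  \<open>P\<close> with respect to \<open>R i\<close> is at most \<open>C\<close>; this form needs no densities.\<close>
definition kl_sum_le :: "'b measure \<Rightarrow> 'i set \<Rightarrow> 'b measure \<Rightarrow> ('i \<Rightarrow> 'b measure) \<Rightarrow> real \<Rightarrow> bool" where
  "kl_sum_le M I P R C \<longleftrightarrow>
     (\<forall>\<phi>. (\<forall>i\<in>I. \<phi> i \<in> borel_measurable M \<and> (\<exists>c. \<forall>x\<in>space M. \<bar>\<phi> i x\<bar> \<le> c)) \<longrightarrow>
       (\<Sum>i\<in>I. (\<integral>x. \<phi> i x \<partial>P) - ln (\<integral>x. exp (\<phi> i x) \<partial>R i)) \<le> C)"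

section \<open>Bounded integrals against probability kernels\<close>

lemma integrable_prob_algebra_bounded:
  fixes f :: "'b \<Rightarrow> real"
  assumes "P \<in> space (prob_algebra M)" "f \<in> borel_measurable M" "\<And>x. x \<in> space M \<Longrightarrow> \<bar>f x\<bar> \<le> c"
  shows "integrable P f"
proof -
  have P: "sets P = sets M" "prob_space P" using assms(1) by (auto simp: space_prob_algebra)
  interpret prob_space P by fact
  have [simp]: "space P = space M" using P(1) by (rule sets_eq_imp_space_eq)
  show ?thesis
    using assms P(1) by (intro integrable_const_bound[where B = c]) (auto cong: measurable_cong_sets)
qed

lemma integral_prob_algebra_ge:
  fixes f :: "'b \<Rightarrow> real"
  assumes "P \<in> space (prob_algebra M)" "integrable P f" "\<And>x. x \<in> space M \<Longrightarrow> c \<le> f x"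
  shows "c \<le> (\<integral>x. f x \<partial>P)"
proof -
  have P: "sets P = sets M" "prob_space P" using assms(1) by (auto simp: space_prob_algebra)
  interpret prob_space P by fact
  show ?thesis
    using assms sets_eq_imp_space_eq[OF P(1)] by (intro integral_ge_const) auto
qed

lemma integral_prob_algebra_le:
  fixes f :: "'b \<Rightarrow> real"
  assumes "P \<in> space (prob_algebra M)" "integrable P f" "\<And>x. x \<in> space M \<Longrightarrow> f x \<le> c"
  shows "(\<integral>x. f x \<partial>P) \<le> c"
proof -
  have P: "sets P = sets M" "prob_space P" using assms(1) by (auto simp: space_prob_algebra)
  interpret prob_space P by fact
  show ?thesis
    using assms sets_eq_imp_space_eq[OF P(1)] by (intro integral_le_const) auto
qed

lemma integral_prob_algebra_bind:
  fixes f :: "'b \<Rightarrow> real"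
  assumes P: "P \<in> space (prob_algebra M)" and k: "\<kappa> \<in> M \<rightarrow>\<^sub>M prob_algebra N"
    and f: "f \<in> borel_measurable N" "\<And>x. x \<in> space N \<Longrightarrow> \<bar>f x\<bar> \<le> c"
  shows "(\<integral>x. f x \<partial>(P \<bind> \<kappa>)) = (\<integral>x. (\<integral>y. f y \<partial>\<kappa> x) \<partial>P)"
proof -
  have P': "sets P = sets M" "prob_space P" using P by (auto simp: space_prob_algebra)
  interpret prob_space P by fact
  have ne: "space P \<noteq> {}" by (rule not_empty)
  have k': "\<kappa> \<in> P \<rightarrow>\<^sub>M prob_algebra N" using k P'(1) by (simp cong: measurable_cong_sets)
  have 1: "emeasure (\<kappa> x) (space (\<kappa> x)) \<le> ennreal 1" if "x \<in> space P" for x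
    using measurable_space[OF k' that] by (auto simp: space_prob_algebra prob_space.emeasure_space_1)
  show ?thesis
    by (rule integral_bind[where K = N and B' = 1, OF f(1) f(2) measurable_prob_algebraD[OF k'] finite_measure_axioms])
      (use ne 1 in auto)
qed

text \<open>This makes the logarithm of an exponential moment a test function as good as
  \<open>f\<close> itself: it is well defined and obeys the same bound \<open>c\<close>, so it can
  be fed back into \<open>kl_sum_le\<close>.\<close>

lemma integral_exp_bounds:
  fixes f :: "'b \<Rightarrow> real"
  assumes P: "P \<in> space (prob_algebra M)" and f: "f \<in> borel_measurable M" "\<And>x. x \<in> space M \<Longrightarrow> \<bar>f x\<bar> \<le> c"
  shows "integrable P (\<lambda>x. exp (f x))" "exp (- c) \<le> (\<integral>x. exp (f x) \<partial>P)"
    "(\<integral>x. exp (f x) \<partial>P) \<le> exp c" "0 < (\<integral>x. exp (f x) \<partial>P)" "\<bar>ln (\<integral>x. exp (f x) \<partial>P)\<bar> \<le> c"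
proof -
  have b: "exp (- c) \<le> exp (f x)" "exp (f x) \<le> exp c" if "x \<in> space M" for x
    using f(2)[OF that] by auto
  show i: "integrable P (\<lambda>x. exp (f x))"
    using b by (intro integrable_prob_algebra_bounded[OF P, where c = "exp c"])
      (auto intro!: borel_measurable_exp measurable_compose[OF f(1)])
  show l: "exp (- c) \<le> (\<integral>x. exp (f x) \<partial>P)" and u: "(\<integral>x. exp (f x) \<partial>P) \<le> exp c"
    using b by (auto intro!: integral_prob_algebra_ge[OF P i] integral_prob_algebra_le[OF P i])
  show p: "0 < (\<integral>x. exp (f x) \<partial>P)" using l exp_gt_zero[of "- c"] by linarith
  have "- c \<le> ln (\<integral>x. exp (f x) \<partial>P)" using l p by (subst ln_ge_iff) auto
  moreover have "ln (\<integral>x. exp (f x) \<partial>P) \<le> c" using u p by (metis exp_gt_zero ln_exp ln_le_cancel_iff)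
  ultimately show "\<bar>ln (\<integral>x. exp (f x) \<partial>P)\<bar> \<le> c" by auto
qed

text \<open>The chain rule: the test function for the first stage is \<open>ln (\<integral>y. exp (\<phi> i y) \<partial>\<kappa>' i x)\<close>.\<close>
lemma kl_sum_le_bind:
  assumes P: "P \<in> space (prob_algebra M)" and R: "\<And>i. i \<in> I \<Longrightarrow> R i \<in> space (prob_algebra M)"
    and k: "\<kappa> \<in> M \<rightarrow>\<^sub>M prob_algebra N" and k': "\<And>i. i \<in> I \<Longrightarrow> \<kappa>' i \<in> M \<rightarrow>\<^sub>M prob_algebra N"
    and 1: "kl_sum_le M I P R C" and 2: "\<And>x. x \<in> space M \<Longrightarrow> kl_sum_le N I (\<kappa> x) (\<lambda>i. \<kappa>' i x) C'"
  shows "kl_sum_le N I (P \<bind> \<kappa>) (\<lambda>i. R i \<bind> \<kappa>' i) (C + C')"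
  unfolding kl_sum_le_def
proof (intro allI impI)
  fix \<phi> :: "_ \<Rightarrow> _ \<Rightarrow> real"
  assume \<phi>: "\<forall>i\<in>I. \<phi> i \<in> borel_measurable N \<and> (\<exists>c. \<forall>x\<in>space N. \<bar>\<phi> i x\<bar> \<le> c)"
  then obtain c where c: "\<And>i x. i \<in> I \<Longrightarrow> x \<in> space N \<Longrightarrow> \<bar>\<phi> i x\<bar> \<le> c i"
    by metis
  have m: "\<phi> i \<in> borel_measurable N" if "i \<in> I" for i using \<phi> that by auto
  define \<psi> where "\<psi> i x = ln (\<integral>y. exp (\<phi> i y) \<partial>\<kappa>' i x)" for i x
  define \<eta> where "\<eta> i x = (\<integral>y. \<phi> i y \<partial>\<kappa> x)" for i x
  have kx: "\<kappa> x \<in> space (prob_algebra N)" if "x \<in> space M" for x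
    using measurable_space[OF k that] .
  have kx': "\<kappa>' i x \<in> space (prob_algebra N)" if "x \<in> space M" "i \<in> I" for x i
    using measurable_space[OF k' that(1)] that(2) .
  have em: "(\<lambda>x. exp (\<phi> i x)) \<in> borel_measurable N" if "i \<in> I" for i
    by (rule measurable_compose[OF m[OF that] borel_measurable_exp])
  have \<psi>m: "\<psi> i \<in> borel_measurable M" if "i \<in> I" for i
    unfolding \<psi>_def
    by (intro borel_measurable_ln measurable_compose[OF measurable_prob_algebraD[OF k'[OF that]]
          integral_measurable_subprob_algebra] em that)
  have \<psi>b: "\<bar>\<psi> i x\<bar> \<le> c i" if "i \<in> I" "x \<in> space M" for i x
    unfolding \<psi>_def using integral_exp_bounds(5)[OF kx' m c] that by blast
  have \<eta>m: "\<eta> i \<in> borel_measurable M" if "i \<in> I" for i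
    unfolding \<eta>_def
    by (intro measurable_compose[OF measurable_prob_algebraD[OF k]
          integral_measurable_subprob_algebra] m that)
  have \<eta>b: "\<bar>\<eta> i x\<bar> \<le> c i" if "i \<in> I" "x \<in> space M" for i x
  proof -
    have i: "integrable (\<kappa> x) (\<phi> i)"
      using integrable_prob_algebra_bounded[OF kx m c] that by blast
    have "- c i \<le> \<phi> i y" "\<phi> i y \<le> c i" if "y \<in> space N" for y
      using c[OF \<open>i \<in> I\<close> that] by auto
    then show ?thesis
      using integral_prob_algebra_le[OF kx i] integral_prob_algebra_ge[OF kx i] that
      unfolding \<eta>_def abs_le_iff by (metis minus_le_iff)
  qed
  have int: "integrable P (\<psi> i)" "integrable P (\<eta> i)" if "i \<in> I" for i
    using that by (auto intro!: integrable_prob_algebra_bounded[OF P, where c = "c i"] \<psi>m \<eta>m \<psi>b \<eta>b)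
  have e1: "(\<integral>x. \<phi> i x \<partial>(P \<bind> \<kappa>)) = (\<integral>x. \<eta> i x \<partial>P)" if "i \<in> I" for i
    unfolding \<eta>_def by (rule integral_prob_algebra_bind[OF P k m c]) (use that in auto)
  \<comment> \<open>Since exp undoes the logarithm in \<open>\<psi>\<close>, the inner integral over
    the second stage collapses and an exponential moment of \<open>\<psi>\<close> over the first
    stage remains.\<close>
  have e2: "(\<integral>x. exp (\<phi> i x) \<partial>(R i \<bind> \<kappa>' i)) = (\<integral>x. exp (\<psi> i x) \<partial>R i)" if "i \<in> I" for i
  proof -
    have "(\<integral>x. exp (\<phi> i x) \<partial>(R i \<bind> \<kappa>' i)) = (\<integral>x. (\<integral>y. exp (\<phi> i y) \<partial>\<kappa>' i x) \<partial>R i)"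
      using c[OF that]
      by (intro integral_prob_algebra_bind[OF R[OF that] k'[OF that] em[OF that], where c = "exp (c i)"]) (auto simp: abs_le_iff)
    also have "\<dots> = (\<integral>x. exp (\<psi> i x) \<partial>R i)"
    proof (rule Bochner_Integration.integral_cong)
      fix x assume "x \<in> space (R i)"
      then have "x \<in> space M" using R[OF that] by (auto simp: space_prob_algebra dest: sets_eq_imp_space_eq)
      from integral_exp_bounds(4)[OF kx'[OF this that] m[OF that] c[OF that]]
      show "(\<integral>y. exp (\<phi> i y) \<partial>\<kappa>' i x) = exp (\<psi> i x)" by (simp add: \<psi>_def)
    qed simp
    finally show ?thesis .
  qed
  \<comment> \<open>Inserting the mean of \<open>\<psi>\<close> under \<open>P\<close> splits the
    sum into the second-stage part, averaged over \<open>P\<close>, and the first-stage part with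
    test function \<open>\<psi>\<close>.\<close>
  have "(\<Sum>i\<in>I. (\<integral>x. \<phi> i x \<partial>(P \<bind> \<kappa>)) - ln (\<integral>x. exp (\<phi> i x) \<partial>(R i \<bind> \<kappa>' i)))
     = (\<Sum>i\<in>I. (\<integral>x. \<eta> i x \<partial>P) - (\<integral>x. \<psi> i x \<partial>P)) + (\<Sum>i\<in>I. (\<integral>x. \<psi> i x \<partial>P) - ln (\<integral>x. exp (\<psi> i x) \<partial>R i))"
    unfolding sum.distrib[symmetric] by (intro sum.cong) (auto simp: e1 e2)
  also have "(\<Sum>i\<in>I. (\<integral>x. \<psi> i x \<partial>P) - ln (\<integral>x. exp (\<psi> i x) \<partial>R i)) \<le> C"
    using 1 \<psi>m \<psi>b unfolding kl_sum_le_def by blast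
  also have "(\<Sum>i\<in>I. (\<integral>x. \<eta> i x \<partial>P) - (\<integral>x. \<psi> i x \<partial>P)) = (\<integral>x. (\<Sum>i\<in>I. \<eta> i x - \<psi> i x) \<partial>P)"
    using int by (subst Bochner_Integration.integral_sum) (auto intro!: sum.cong Bochner_Integration.integral_diff[symmetric])
  also have "\<dots> \<le> C'"
  proof (rule integral_prob_algebra_le[OF P])
    show "integrable P (\<lambda>x. \<Sum>i\<in>I. \<eta> i x - \<psi> i x)" using int by auto
    fix x assume "x \<in> space M"
    from 2[OF this] \<phi> show "(\<Sum>i\<in>I. \<eta> i x - \<psi> i x) \<le> C'"
      unfolding kl_sum_le_def \<eta>_def \<psi>_def by blast
  qed
  finally show "(\<Sum>i\<in>I. (\<integral>x. \<phi> i x \<partial>(P \<bind> \<kappa>)) - ln (\<integral>x. exp (\<phi> i x) \<partial>(R i \<bind> \<kappa>' i))) \<le> C + C'"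
    by simp
qed

text \<open>Jensen's inequality for exp. With the chain rule it says that stages common to all
  hypotheses (initial history, choice of a query, recording, final output) cost nothing.\<close>

lemma kl_sum_le_refl:
  assumes P: "P \<in> space (prob_algebra M)"
  shows "kl_sum_le M I P (\<lambda>_. P) 0"
  unfolding kl_sum_le_def
proof (intro allI impI sum_nonpos)
  fix \<phi> :: "_ \<Rightarrow> _ \<Rightarrow> real" and i
  assume \<phi>: "\<forall>i\<in>I. \<phi> i \<in> borel_measurable M \<and> (\<exists>c. \<forall>x\<in>space M. \<bar>\<phi> i x\<bar> \<le> c)" and i: "i \<in> I"
  then obtain c where c: "\<And>x. x \<in> space M \<Longrightarrow> \<bar>\<phi> i x\<bar> \<le> c" and m: "\<phi> i \<in> borel_measurable M" by blast
  interpret prob_space P using P by (auto simp: space_prob_algebra)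
  define z where "z = (\<integral>x. exp (\<phi> i x) \<partial>P)"
  have z: "integrable P (\<lambda>x. exp (\<phi> i x))" "0 < z"
    using integral_exp_bounds[OF P m c] by (auto simp: z_def)
  have int: "integrable P (\<phi> i)" by (rule integrable_prob_algebra_bounded[OF P m c])
  \<comment> \<open>Tangent-line inequality for exp, shifted by \<open>ln z\<close> so that the
    right side integrates to 1.\<close>
  have "1 + (\<phi> i x - ln z) \<le> exp (\<phi> i x) / z" for x
    using exp_ge_add_one_self[of "\<phi> i x - ln z"] z(2) by (simp add: exp_diff)
  then have "(\<integral>x. 1 + (\<phi> i x - ln z) \<partial>P) \<le> (\<integral>x. exp (\<phi> i x) / z \<partial>P)"
    using int z by (intro integral_mono) auto
  then have "1 + ((\<integral>x. \<phi> i x \<partial>P) - ln z) \<le> 1"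
    using int z by (simp add: prob_space) (simp add: z_def)
  then show "(\<integral>x. \<phi> i x \<partial>P) - ln (\<integral>x. exp (\<phi> i x) \<partial>P) \<le> 0" by (simp add: z_def)
qed

subsection \<open>Biased sign vectors\<close>

definition spin :: "bool \<Rightarrow> real" where
  "spin x = (if x then 1 else - 1)"

definition flip :: "'i set \<Rightarrow> 'i \<Rightarrow> 'i set" where
  "flip V i = (if i \<in> V then V - {i} else insert i V)"

lemma spin_flip: "spin (j \<in> flip V i) = (if i = j then - spin (j \<in> V) else spin (j \<in> V))"
  by (auto simp: flip_def spin_def)

text \<open>Under this product law \<open>spin (s i)\<close> has mean
  \<open>\<theta> * spin (i \<in> V)\<close> for \<open>i \<in> I\<close>. Coordinates outside
  \<open>I\<close> are frozen at \<open>False\<close>, which keeps the support finite.\<close>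

definition biased_signs :: "'i set \<Rightarrow> real \<Rightarrow> 'i set \<Rightarrow> ('i \<Rightarrow> bool) pmf" where
  "biased_signs I \<theta> V = Pi_pmf I False (\<lambda>i. bernoulli_pmf ((1 + \<theta> * spin (i \<in> V)) / 2))"

abbreviation sign_vectors :: "'i set \<Rightarrow> ('i \<Rightarrow> bool) set" where
  "sign_vectors I \<equiv> PiE_dflt I False (\<lambda>_. UNIV)"

text \<open>This is \<open>1 - (1 - \<theta> * t) / (1 + \<theta> * t)\<close> with
  \<open>t = spin (i \<in> V) * spin (s i)\<close>, that is, one minus the likelihood ratio of the
  flipped law to the original one.\<close>

definition score :: "real \<Rightarrow> 'i set \<Rightarrow> 'i \<Rightarrow> ('i \<Rightarrow> bool) \<Rightarrow> real" where
  "score \<theta> V i s = 2 * \<theta> * (spin (i \<in> V) * spin (s i)) / (1 + \<theta> * (spin (i \<in> V) * spin (s i)))"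

context
  fixes I :: "'i set" and \<theta> :: real
  assumes I: "finite I" and \<theta>: "0 < \<theta>" "\<theta> < 1"
begin

lemma finite_sign_vectors: "finite (sign_vectors I)"
  using I by auto

lemma set_pmf_biased_signs: "set_pmf (biased_signs I \<theta> V) \<subseteq> sign_vectors I"
  using set_Pi_pmf_subset'[OF I, of False] unfolding biased_signs_def by (fastforce simp: PiE_dflt_def)

lemma integrable_biased_signs: "integrable (biased_signs I \<theta> V) (f :: _ \<Rightarrow> 'b::{banach, second_countable_topology})"
  by (rule integrable_measure_pmf_finite) (rule finite_subset[OF set_pmf_biased_signs finite_sign_vectors])

lemma expectation_biased_signs:
  "measure_pmf.expectation (biased_signs I \<theta> V) f
     = (\<Sum>s\<in>sign_vectors I. pmf (biased_signs I \<theta> V) s * (f s :: real))"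
  by (subst integral_measure_pmf[OF finite_sign_vectors]) (use set_pmf_biased_signs in auto)

lemma bias_bounds: "0 \<le> (1 + \<theta> * spin x) / 2" "(1 + \<theta> * spin x) / 2 \<le> 1"
  using \<theta> by (auto simp: spin_def)

lemma pmf_biased_signs:
  assumes "s \<in> sign_vectors I"
  shows "pmf (biased_signs I \<theta> V) s = (\<Prod>i\<in>I. (1 + \<theta> * (spin (i \<in> V) * spin (s i))) / 2)"
proof -
  have "pmf (bernoulli_pmf ((1 + \<theta> * spin (i \<in> V)) / 2)) (s i) = (1 + \<theta> * (spin (i \<in> V) * spin (s i))) / 2" for i
    using bias_bounds[of "i \<in> V"] by (cases "s i") (auto simp: spin_def field_simps)
  note eq = this
  have "s x = False" if "x \<notin> I" for x using assms that by (auto simp: PiE_dflt_def)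
  then show ?thesis
    unfolding biased_signs_def by (subst pmf_Pi'[OF I]) (simp_all add: eq)
qed

text \<open>Change of measure: the two laws differ only in the factor of coordinate
  \<open>i\<close>, and the score is their relative difference.\<close>

lemma expectation_flip:
  assumes i: "i \<in> I"
  shows "measure_pmf.expectation (biased_signs I \<theta> V) (\<lambda>s. score \<theta> V i s * f s)
    = measure_pmf.expectation (biased_signs I \<theta> V) f
      - measure_pmf.expectation (biased_signs I \<theta> (flip V i)) f"
proof -
  have "pmf (biased_signs I \<theta> V) s * (score \<theta> V i s * f s)
     = pmf (biased_signs I \<theta> V) s * f s - pmf (biased_signs I \<theta> (flip V i)) s * f s"
    if s: "s \<in> sign_vectors I" for s
  proof -
    define t where "t = spin (i \<in> V) * spin (s i)"
    \<comment> \<open>The factor shared by both laws; flipping \<open>i\<close> replaces only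
      \<open>1 + \<theta> * t\<close> by \<open>1 - \<theta> * t\<close>.\<close>
    define P where "P = (\<Prod>j\<in>I - {i}. (1 + \<theta> * (spin (j \<in> V) * spin (s j))) / 2)"
    have t: "1 + \<theta> * t > 0" using \<theta> by (auto simp: t_def spin_def)
    have 1: "pmf (biased_signs I \<theta> V) s = (1 + \<theta> * t) / 2 * P"
      unfolding pmf_biased_signs[OF s] P_def t_def by (rule prod.remove[OF I i])
    have "pmf (biased_signs I \<theta> (flip V i)) s = (1 - \<theta> * t) / 2 *
        (\<Prod>j\<in>I - {i}. (1 + \<theta> * (spin (j \<in> flip V i) * spin (s j))) / 2)"
      unfolding pmf_biased_signs[OF s] t_def by (subst prod.remove[OF I i]) (simp add: spin_flip)
    also have "(\<Prod>j\<in>I - {i}. (1 + \<theta> * (spin (j \<in> flip V i) * spin (s j))) / 2) = P"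
      unfolding P_def by (rule prod.cong) (auto simp: spin_flip)
    finally have 2: "pmf (biased_signs I \<theta> (flip V i)) s = (1 - \<theta> * t) / 2 * P" .
    have sc: "score \<theta> V i s = 2 * \<theta> * t / (1 + \<theta> * t)" by (simp add: score_def t_def)
    have "(1 + \<theta> * t) / 2 * P * (2 * \<theta> * t / (1 + \<theta> * t) * f s) = \<theta> * t * P * f s"
      using t by (simp add: field_simps)
    then show ?thesis unfolding 1 2 sc by (simp add: field_simps)
  qed
  then show ?thesis
    unfolding expectation_biased_signs sum_subtractf[symmetric] by (intro sum.cong) auto
qed

lemma expectation_component:
  assumes "i \<in> I"
  shows "measure_pmf.expectation (biased_signs I \<theta> V) (\<lambda>s. h (s i) :: real)
    = h True * ((1 + \<theta> * spin (i \<in> V)) / 2) + h False * ((1 - \<theta> * spin (i \<in> V)) / 2)"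
proof -
  have "map_pmf (\<lambda>s. s i) (biased_signs I \<theta> V) = bernoulli_pmf ((1 + \<theta> * spin (i \<in> V)) / 2)"
    using assms unfolding biased_signs_def by (simp add: Pi_pmf_component[OF I])
  then have "measure_pmf.expectation (biased_signs I \<theta> V) (\<lambda>s. h (s i))
      = measure_pmf.expectation (bernoulli_pmf ((1 + \<theta> * spin (i \<in> V)) / 2)) h"
    by (metis integral_map_pmf)
  also have "\<dots> = h True * ((1 + \<theta> * spin (i \<in> V)) / 2) + h False * (1 - (1 + \<theta> * spin (i \<in> V)) / 2)"
    using bias_bounds by (subst integral_bernoulli_pmf) (auto simp: mult.commute)
  also have "1 - (1 + \<theta> * spin (i \<in> V)) / 2 = (1 - \<theta> * spin (i \<in> V)) / 2"
    by (simp add: field_simps)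
  finally show ?thesis .
qed

lemma expectation_score: "i \<in> I \<Longrightarrow> measure_pmf.expectation (biased_signs I \<theta> V) (score \<theta> V i) = 0"
  using expectation_flip[of i V "\<lambda>_. 1"] by simp

text \<open>On the diagonal only the marginal of coordinate \<open>i\<close> matters. Off the
  diagonal, flipping \<open>i\<close> leaves the score of \<open>j\<close> unchanged, so by the
  change of measure the product has as mean a difference of two score means, both zero.\<close>

lemma expectation_score_mult:
  assumes i: "i \<in> I" and j: "j \<in> I"
  shows "measure_pmf.expectation (biased_signs I \<theta> V) (\<lambda>s. score \<theta> V i s * score \<theta> V j s)
    = (if i = j then 4 * \<theta>\<^sup>2 / (1 - \<theta>\<^sup>2) else 0)"
proof (cases "i = j")
  case True
  have "measure_pmf.expectation (biased_signs I \<theta> V) (\<lambda>s. score \<theta> V i s * score \<theta> V i s)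
    = 4 * \<theta>\<^sup>2 / (1 + \<theta>)\<^sup>2 * ((1 + \<theta>) / 2) + 4 * \<theta>\<^sup>2 / (1 - \<theta>)\<^sup>2 * ((1 - \<theta>) / 2)"
    unfolding score_def
    \<comment> \<open>The function \<open>h\<close> is the squared score as a function of one sign;
      membership of \<open>i\<close> in \<open>V\<close> merely swaps the two summands.\<close>
    by (subst expectation_component[OF i, where h = "\<lambda>x. 2 * \<theta> * (spin (i \<in> V) * spin x) / (1 + \<theta> * (spin (i \<in> V) * spin x))
        * (2 * \<theta> * (spin (i \<in> V) * spin x) / (1 + \<theta> * (spin (i \<in> V) * spin x)))"])
      (auto simp: spin_def power2_eq_square)
  also have "\<dots> = 2 * \<theta>\<^sup>2 / (1 + \<theta>) + 2 * \<theta>\<^sup>2 / (1 - \<theta>)"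
  proof -
    have "4 * \<theta>\<^sup>2 / x\<^sup>2 * (x / 2) = 2 * \<theta>\<^sup>2 / x" if "x \<noteq> 0" for x
      using that by (simp add: power2_eq_square)
    note this[of "1 + \<theta>"] this[of "1 - \<theta>"] then show ?thesis using \<theta> by (metis add_pos_pos diff_gt_0_iff_gt less_numeral_extra(1,3))
  qed
  also have "\<dots> = 4 * \<theta>\<^sup>2 / (1 - \<theta>\<^sup>2)"
  proof -
    have "1 - \<theta>\<^sup>2 = (1 + \<theta>) * (1 - \<theta>)" by (simp add: power2_eq_square algebra_simps)
    then show ?thesis using \<theta> by (simp add: add_frac_eq) (simp add: algebra_simps)
  qed
  finally show ?thesis using True by simp
next
  case False
  have sc: "score \<theta> V j = score \<theta> (flip V i) j"
    using False by (simp add: fun_eq_iff score_def spin_flip)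
  have "measure_pmf.expectation (biased_signs I \<theta> V) (\<lambda>s. score \<theta> V i s * score \<theta> V j s)
    = measure_pmf.expectation (biased_signs I \<theta> V) (score \<theta> V j)
      - measure_pmf.expectation (biased_signs I \<theta> (flip V i)) (score \<theta> (flip V i) j)"
    unfolding expectation_flip[OF i] sc[symmetric] ..
  then show ?thesis using False by (simp only: expectation_score[OF j] if_False diff_self)
qed

text \<open>By \<open>expectation_flip\<close> each difference is the inner product of
  \<open>g\<close> with a score. The scores are orthogonal with common squared norm
  \<open>4 * \<theta>\<^sup>2 / (1 - \<theta>\<^sup>2)\<close>, so Bessel's inequality bounds all
  differences together and no factor \<open>card I\<close> appears.\<close>

lemma bessel_biased_signs:
  "(\<Sum>i\<in>I. (measure_pmf.expectation (biased_signs I \<theta> V) g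
        - measure_pmf.expectation (biased_signs I \<theta> (flip V i)) g)\<^sup>2)
     \<le> 4 * \<theta>\<^sup>2 / (1 - \<theta>\<^sup>2) * measure_pmf.expectation (biased_signs I \<theta> V) (\<lambda>s. (g s)\<^sup>2)"
proof -
  let ?E = "measure_pmf.expectation (biased_signs I \<theta> V)"
  define c where "c i = ?E (\<lambda>s. score \<theta> V i s * g s)" for i
  define v where "v = 4 * \<theta>\<^sup>2 / (1 - \<theta>\<^sup>2)"
  have v: "v > 0" using \<theta> by (auto simp: v_def power_less_one_iff intro!: divide_pos_pos)
  note [simp] = integrable_biased_signs
  have "?E (\<lambda>s. (\<Sum>i\<in>I. c i * score \<theta> V i s)\<^sup>2)
      = ?E (\<lambda>s. \<Sum>i\<in>I. \<Sum>j\<in>I. c i * c j * (score \<theta> V i s * score \<theta> V j s))"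
    by (simp add: power2_eq_square sum_product mult_ac)
  also have "\<dots> = (\<Sum>i\<in>I. \<Sum>j\<in>I. c i * c j * (if i = j then v else 0))"
    unfolding v_def by (simp, intro sum.cong refl) (simp add: expectation_score_mult)
  also have "\<dots> = v * (\<Sum>i\<in>I. (c i)\<^sup>2)"
  proof -
    have "(\<Sum>j\<in>I. c i * c j * (if i = j then v else 0)) = v * (c i)\<^sup>2" if "i \<in> I" for i
    proof -
      have "(\<Sum>j\<in>I. c i * c j * (if i = j then v else 0)) = (\<Sum>j\<in>I. if i = j then v * (c i)\<^sup>2 else 0)"
        by (rule sum.cong) (auto simp: power2_eq_square)
      then show ?thesis using I that by simp
    qed
    then show ?thesis by (simp add: sum_distrib_left)
  qed
  finally have 1: "?E (\<lambda>s. (\<Sum>i\<in>I. c i * score \<theta> V i s)\<^sup>2) = v * (\<Sum>i\<in>I. (c i)\<^sup>2)" .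
  have "?E (\<lambda>s. g s * (\<Sum>i\<in>I. c i * score \<theta> V i s)) = ?E (\<lambda>s. \<Sum>i\<in>I. c i * (score \<theta> V i s * g s))"
    by (simp add: sum_distrib_left mult_ac)
  also have "\<dots> = (\<Sum>i\<in>I. (c i)\<^sup>2)"
    by (simp add: c_def power2_eq_square)
  finally have 2: "?E (\<lambda>s. g s * (\<Sum>i\<in>I. c i * score \<theta> V i s)) = (\<Sum>i\<in>I. (c i)\<^sup>2)" .
  \<comment> \<open>The residual of the orthogonal projection of \<open>g\<close>, scaled by
    \<open>v\<close> to avoid division.\<close>
  have "0 \<le> ?E (\<lambda>s. (v * g s - (\<Sum>i\<in>I. c i * score \<theta> V i s))\<^sup>2)"
    by (rule Bochner_Integration.integral_nonneg) auto
  also have "\<dots> = ?E (\<lambda>s. v\<^sup>2 * (g s)\<^sup>2 - 2 * v * (g s * (\<Sum>i\<in>I. c i * score \<theta> V i s)) + (\<Sum>i\<in>I. c i * score \<theta> V i s)\<^sup>2)"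
    by (simp add: power2_diff power_mult_distrib mult_ac)
  also have "\<dots> = v\<^sup>2 * ?E (\<lambda>s. (g s)\<^sup>2) - 2 * v * (\<Sum>i\<in>I. (c i)\<^sup>2) + v * (\<Sum>i\<in>I. (c i)\<^sup>2)"
    by (simp add: 1 2)
  finally have "0 \<le> v * (v * ?E (\<lambda>s. (g s)\<^sup>2) - (\<Sum>i\<in>I. (c i)\<^sup>2))"
    by (simp add: power2_eq_square algebra_simps)
  then have "(\<Sum>i\<in>I. (c i)\<^sup>2) \<le> v * ?E (\<lambda>s. (g s)\<^sup>2)"
    using v by (simp add: zero_le_mult_iff)
  then show ?thesis by (simp add: c_def v_def expectation_flip cong: sum.cong)
qed

text \<open>Here \<open>w s\<close> stands for the density of a channel output at one fixed point,
  given input \<open>s\<close>. Subtracting the minimum of \<open>w\<close> does not change the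
  differences of means, and privacy keeps what remains within \<open>e - 1\<close> times that
  minimum; this is the source of the factor \<open>(e - 1)\<^sup>2\<close>.\<close>

lemma chi_square_biased_signs:
  assumes w: "\<And>s s'. s \<in> sign_vectors I \<Longrightarrow> s' \<in> sign_vectors I \<Longrightarrow> 0 \<le> w s \<and> w s \<le> e * w s'"
  defines "m \<equiv> \<lambda>V. measure_pmf.expectation (biased_signs I \<theta> V) w"
  shows "(\<Sum>i\<in>I. (m V - m (flip V i))\<^sup>2 / m (flip V i)) \<le> 4 * \<theta>\<^sup>2 / (1 - \<theta>\<^sup>2) * (e - 1)\<^sup>2 * m V"
proof -
  let ?F = "sign_vectors I"
  define a where "a = Min (w ` ?F)"
  have ne: "?F \<noteq> {}" by auto
  have fin: "finite (w ` ?F)" using finite_sign_vectors by auto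
  have "a \<in> w ` ?F" unfolding a_def using fin ne by (intro Min_in) auto
  then obtain s0 where s0: "s0 \<in> ?F" "a = w s0" by blast
  have "a \<le> w s" if "s \<in> ?F" for s using that fin by (simp add: a_def)
  with s0 have wa: "0 \<le> a" "a \<le> w s" "w s \<le> e * a" if "s \<in> ?F" for s
    using that w[OF that s0(1)] w[OF s0(1) that] s0(2) by simp_all
  have a0: "0 \<le> a" using wa ne by blast
  note [simp] = integrable_biased_signs
  have ae: "AE s in biased_signs I \<theta> U. s \<in> ?F" for U
    using set_pmf_biased_signs by (auto simp: AE_measure_pmf_iff)
  have am: "a \<le> m U" for U
  proof -
    have "measure_pmf.expectation (biased_signs I \<theta> U) (\<lambda>_. a) \<le> m U"
      unfolding m_def by (rule integral_mono_AE) (use ae[of U] wa in \<open>auto elim!: eventually_mono\<close>)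
    then show ?thesis by simp
  qed
  define K where "K = 4 * \<theta>\<^sup>2 / (1 - \<theta>\<^sup>2)"
  have K: "K \<ge> 0" using \<theta> by (auto simp: K_def power_le_one_iff intro!: divide_nonneg_nonneg)
  have sq: "measure_pmf.expectation (biased_signs I \<theta> V) (\<lambda>s. (w s - a)\<^sup>2) \<le> ((e - 1) * a)\<^sup>2"
  proof -
    have "measure_pmf.expectation (biased_signs I \<theta> V) (\<lambda>s. (w s - a)\<^sup>2)
        \<le> measure_pmf.expectation (biased_signs I \<theta> V) (\<lambda>s. ((e - 1) * a)\<^sup>2)"
    proof (rule integral_mono_AE)
      show "AE s in biased_signs I \<theta> V. (w s - a)\<^sup>2 \<le> ((e - 1) * a)\<^sup>2"
        using ae[of V]
      proof eventually_elim
        case (elim s)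
        from wa[OF this] show ?case by (intro power_mono) (auto simp: algebra_simps)
      qed
    qed auto
    then show ?thesis by simp
  qed
  have B: "(\<Sum>i\<in>I. (m V - m (flip V i))\<^sup>2) \<le> K * ((e - 1) * a)\<^sup>2"
  proof -
    \<comment> \<open>Bessel is applied to \<open>w - a\<close>, since the constant \<open>a\<close>
      cancels in every difference.\<close>
    have "(\<Sum>i\<in>I. (m V - m (flip V i))\<^sup>2) \<le> K * measure_pmf.expectation (biased_signs I \<theta> V) (\<lambda>s. (w s - a)\<^sup>2)"
      using bessel_biased_signs[of V "\<lambda>s. w s - a"] by (simp add: m_def K_def)
    also have "\<dots> \<le> K * ((e - 1) * a)\<^sup>2" by (rule mult_left_mono[OF sq K])
    finally show ?thesis .
  qed
  show ?thesis
  \<comment> \<open>If the minimum is 0, the ratio bound forces \<open>w\<close> to vanish on all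
    sign vectors, and the quotients are \<open>0 / 0 = 0\<close>.\<close>
  proof (cases "a = 0")
    case True
    then have "w s = 0" if "s \<in> ?F" for s using wa[OF that] by simp
    then have "m U = 0" for U unfolding m_def expectation_biased_signs by simp
    then show ?thesis by simp
  next
    case False
    then have a: "a > 0" using a0 by simp
    \<comment> \<open>All means are at least \<open>a\<close>. This is used for the denominators
      here and, at the end, to replace the remaining factor \<open>a\<close> by
      \<open>m V\<close>.\<close>
    have "(\<Sum>i\<in>I. (m V - m (flip V i))\<^sup>2 / m (flip V i)) \<le> (\<Sum>i\<in>I. (m V - m (flip V i))\<^sup>2 / a)"
      using a am by (intro sum_mono divide_left_mono) (auto intro!: mult_pos_pos elim: less_le_trans)
    also have "\<dots> \<le> K * ((e - 1) * a)\<^sup>2 / a"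
      unfolding sum_divide_distrib[symmetric] using B a by (simp add: divide_right_mono)
    also have "\<dots> = K * (e - 1)\<^sup>2 * a" using a by (simp add: power2_eq_square)
    also have "\<dots> \<le> K * (e - 1)\<^sup>2 * m V" using am K by (intro mult_left_mono) auto
    finally show ?thesis by (simp add: K_def)
  qed
qed

end

subsection \<open>Private channels\<close>

text \<open>Testing the setwise inequality on the set where the pointwise one fails shows that a
  nonnegative function has integral zero. It turns the privacy condition on events into one on
  densities.\<close>

lemma density_le_AE:
  fixes f g :: "'b \<Rightarrow> real"
  assumes f: "integrable M f" and g: "integrable M g"
    and nn: "\<And>x. 0 \<le> f x" "\<And>x. 0 \<le> g x" and e: "0 \<le> e"
    and le: "\<And>A. A \<in> sets M \<Longrightarrow> measure (density M f) A \<le> e * measure (density M g) A"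
  shows "AE x in M. f x \<le> e * g x"
proof -
  have [measurable]: "f \<in> borel_measurable M" "g \<in> borel_measurable M" using f g by auto
  define A where "A = {x \<in> space M. e * g x < f x}"
  have A[measurable]: "A \<in> sets M" unfolding A_def by measurable
  have ms: "measure (density M (\<lambda>x. ennreal (h x))) A = (\<integral>x. h x * indicator A x \<partial>M)"
    if "integrable M h" "\<And>x. 0 \<le> h x" for h :: "'b \<Rightarrow> real"
  proof -
    have [measurable]: "h \<in> borel_measurable M" using that by auto
    have "measure (density M h) A = enn2real (\<integral>\<^sup>+x. ennreal (h x * indicator A x) \<partial>M)"
      unfolding measure_def by (subst emeasure_density) (auto simp: ennreal_mult' ennreal_indicator that)
    also have "\<dots> = (\<integral>x. h x * indicator A x \<partial>M)"
      by (subst integral_eq_nn_integral) (auto simp: that)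
    finally show ?thesis .
  qed
  have int: "integrable M (\<lambda>x. h x * indicator A x)" if "integrable M h" for h :: "'b \<Rightarrow> real"
    using integrable_real_mult_indicator[OF A that] by (simp add: mult.commute)
  have nn': "0 \<le> (f x - e * g x) * indicator A x" for x
    by (auto simp: A_def indicator_def)
  have "(\<integral>x. (f x - e * g x) * indicator A x \<partial>M)
      = (\<integral>x. f x * indicator A x \<partial>M) - e * (\<integral>x. g x * indicator A x \<partial>M)"
    using int[OF f] int[OF g] by (simp add: left_diff_distrib mult.assoc)
  also have "\<dots> \<le> 0" using le[OF A] ms[OF f nn(1)] ms[OF g nn(2)] by simp
  finally have "(\<integral>x. (f x - e * g x) * indicator A x \<partial>M) = 0"
    using nn' by (intro antisym Bochner_Integration.integral_nonneg) auto
  moreover have "integrable M (\<lambda>x. (f x - e * g x) * indicator A x)"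
    using f g by (intro int) auto
  ultimately have "AE x in M. (f x - e * g x) * indicator A x = 0"
    using nn' by (subst (asm) integral_nonneg_eq_0_iff_AE) auto
  moreover have "AE x in M. x \<in> space M" by (rule AE_space)
  ultimately show ?thesis
    by eventually_elim (auto simp: A_def indicator_def split: if_splits)
qed

text \<open>Pointwise form of the bound of relative entropy by chi-square divergence: the left side
  is largest at \<open>u = ln (a / b)\<close>, and there \<open>ln t \<le> t - 1\<close>
  applies.\<close>

lemma log_likelihood_test_le:
  fixes a b u :: real
  assumes "0 < a" "0 < b"
  shows "u * a - exp u * b + b \<le> (a - b)\<^sup>2 / b"
proof -
  define t where "t = a / b"
  have t: "t > 0" "a = t * b" using assms by (auto simp: t_def)
  have "u * t - exp u \<le> t * ln t - t"
  proof -
    have "1 + (u - ln t) \<le> exp u / t" using exp_ge_add_one_self[of "u - ln t"] t(1) by (simp add: exp_diff)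
    then show ?thesis using t(1) by (simp add: field_simps)
  qed
  also have "\<dots> \<le> t * (t - 1) - t"
    using ln_le_minus_one[OF t(1)] t(1) by (intro diff_right_mono mult_left_mono) auto
  finally have "(u * t - exp u + 1) * b \<le> (t - 1)\<^sup>2 * b"
    using assms(2) by (intro mult_right_mono) (auto simp: power2_eq_square algebra_simps)
  moreover have "(t * b - b)\<^sup>2 / b = (t - 1)\<^sup>2 * b"
    using assms(2) by (simp add: power2_eq_square field_simps)
  ultimately show ?thesis unfolding t(2) by (simp add: algebra_simps)
qed

text \<open>The information bound for one observation. Privacy gives all channel laws densities with
  respect to one of them; at almost every output the test expression is bounded by the chi-square
  sum of the mixtures, and integrating the mixture for \<open>V\<close> gives 1.\<close>

lemma kl_sum_le_biased_signs:
  fixes W :: "('i \<Rightarrow> bool) \<Rightarrow> 'b measure"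
  assumes I: "finite I" and \<theta>: "0 < \<theta>" "\<theta> < 1" and e: "0 \<le> e"
    and W: "\<And>s. W s \<in> space (prob_algebra N)"
    and ldp: "\<And>s s' A. A \<in> sets N \<Longrightarrow> measure (W s) A \<le> e * measure (W s') A"
  shows "kl_sum_le N I (measure_pmf (biased_signs I \<theta> V) \<bind> W)
    (\<lambda>i. measure_pmf (biased_signs I \<theta> (flip V i)) \<bind> W) (4 * \<theta>\<^sup>2 / (1 - \<theta>\<^sup>2) * (e - 1)\<^sup>2)"
  unfolding kl_sum_le_def
proof (intro allI impI)
  fix \<phi> :: "'i \<Rightarrow> 'b \<Rightarrow> real"
  assume \<phi>: "\<forall>i\<in>I. \<phi> i \<in> borel_measurable N \<and> (\<exists>c. \<forall>x\<in>space N. \<bar>\<phi> i x\<bar> \<le> c)"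
  then obtain c where c: "\<And>i x. i \<in> I \<Longrightarrow> x \<in> space N \<Longrightarrow> \<bar>\<phi> i x\<bar> \<le> c i"
    by metis
  have \<phi>m: "\<phi> i \<in> borel_measurable N" if "i \<in> I" for i using \<phi> that by auto
  let ?F = "sign_vectors I"
  \<comment> \<open>The reference measure is the channel law at an arbitrary input; by the ratio
    bound it dominates every \<open>W s\<close>.\<close>
  define \<mu> where "\<mu> = W (\<lambda>_. False)"
  have sW: "sets (W s) = sets N" and pW: "prob_space (W s)" for s
    using W[of s] by (auto simp: space_prob_algebra)
  have s\<mu>: "sets \<mu> = sets N" by (simp add: \<mu>_def sW)
  have sp\<mu>: "space \<mu> = space N" by (rule sets_eq_imp_space_eq[OF s\<mu>])
  interpret \<mu>: prob_space \<mu> unfolding \<mu>_def by (rule pW)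
  have ex: "\<exists>w. w \<in> borel_measurable \<mu> \<and> (\<forall>x. 0 \<le> w x) \<and> W s = density \<mu> (\<lambda>x. ennreal (w x))" for s
  proof -
    interpret Ws: prob_space "W s" by (rule pW)
    have ac: "absolutely_continuous \<mu> (W s)"
      unfolding absolutely_continuous_def
    proof
      fix A assume A: "A \<in> null_sets \<mu>"
      then have "A \<in> sets N" "measure \<mu> A = 0" using s\<mu> by (auto simp: measure_def)
      then have "measure (W s) A \<le> 0" using ldp[of A s "\<lambda>_. False"] by (simp add: \<mu>_def)
      then show "A \<in> null_sets (W s)"
        using A s\<mu> sW[of s] by (auto simp: null_sets_def Ws.emeasure_eq_measure measure_le_0_iff)
    qed
    obtain D where D: "D \<in> borel_measurable \<mu>" "AE x in \<mu>. RN_deriv \<mu> (W s) x = ennreal (D x)" "\<And>x. 0 \<le> D x"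
      using \<mu>.real_RN_deriv[OF Ws.finite_measure_axioms ac] sW s\<mu> by metis
    have "W s = density \<mu> (RN_deriv \<mu> (W s))"
      using \<mu>.density_RN_deriv[OF ac] sW s\<mu> by simp
    also have "\<dots> = density \<mu> (\<lambda>x. ennreal (D x))"
      using D by (intro density_cong) auto
    finally show ?thesis using D by auto
  qed
  obtain w where wm: "\<And>s. w s \<in> borel_measurable \<mu>" and w0: "\<And>s x. 0 \<le> w s x"
    and wd: "\<And>s. W s = density \<mu> (\<lambda>x. ennreal (w s x))"
    using ex by metis
  have wi: "integrable \<mu> (w s)" for s
  proof (rule integrableI_nonneg[OF wm])
    have "(\<integral>\<^sup>+x. ennreal (w s x) \<partial>\<mu>) = emeasure (W s) (space (W s))"
      using wm by (subst (1 2) wd) (simp add: emeasure_density cong: nn_integral_cong)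
    then show "(\<integral>\<^sup>+x. ennreal (w s x) \<partial>\<mu>) < \<infinity>"
      using prob_space.emeasure_space_1[OF pW] by simp
  qed (simp add: w0)
  \<comment> \<open>A single null set serves all pairs because there are only finitely many sign
    vectors.\<close>
  have ae: "AE y in \<mu>. \<forall>s\<in>?F. \<forall>s'\<in>?F. w s y \<le> e * w s' y"
  proof (intro AE_finite_allI finite_sign_vectors[OF I \<theta>])
    fix s s'
    show "AE y in \<mu>. w s y \<le> e * w s' y"
      by (rule density_le_AE[OF wi wi w0 w0 e]) (use ldp s\<mu> wd in metis)
  qed
  define m where "m U y = measure_pmf.expectation (biased_signs I \<theta> U) (\<lambda>s. w s y)" for U y
  have m_sum: "m U y = (\<Sum>s\<in>?F. pmf (biased_signs I \<theta> U) s * w s y)" for U y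
    unfolding m_def by (rule expectation_biased_signs[OF I \<theta>])
  have integrable_m: "integrable \<mu> (\<lambda>y. m U y * f y)"
    and integral_mix: "(\<integral>y. f y \<partial>(measure_pmf (biased_signs I \<theta> U) \<bind> W)) = (\<integral>y. m U y * f y \<partial>\<mu>)"
    if f: "f \<in> borel_measurable N" and b: "\<And>y. y \<in> space N \<Longrightarrow> \<bar>f y\<bar> \<le> b" for U f and b :: real
  proof -
    have fm: "f \<in> borel_measurable \<mu>" using f s\<mu> by (simp cong: measurable_cong_sets)
    have iW: "integrable (W s) f" for s by (rule integrable_prob_algebra_bounded[OF W f b])
    have i: "integrable \<mu> (\<lambda>y. w s y * f y)" for s
      using integrable_real_density[OF wm[of s] _ fm] w0 iW[of s] unfolding wd by simp
    have eq: "(\<integral>y. f y \<partial>W s) = (\<integral>y. w s y * f y \<partial>\<mu>)" for s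
      using integral_real_density[OF wm[of s] _ fm] w0 unfolding wd by simp
    have m_eq: "(\<lambda>y. m U y * f y) = (\<lambda>y. \<Sum>s\<in>?F. pmf (biased_signs I \<theta> U) s * (w s y * f y))"
      by (simp add: m_sum sum_distrib_right mult.assoc)
    show "integrable \<mu> (\<lambda>y. m U y * f y)" unfolding m_eq using i by simp
    have "(\<integral>y. f y \<partial>(measure_pmf (biased_signs I \<theta> U) \<bind> W))
        = measure_pmf.expectation (biased_signs I \<theta> U) (\<lambda>s. \<integral>y. f y \<partial>W s)"
      using W by (intro integral_prob_algebra_bind[OF _ _ f b, where M = "count_space UNIV"])
        (auto simp: space_prob_algebra measure_pmf.prob_space_axioms)
    also have "\<dots> = (\<integral>y. m U y * f y \<partial>\<mu>)"
      unfolding m_eq expectation_biased_signs[OF I \<theta>] eq using i by simp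
    finally show "(\<integral>y. f y \<partial>(measure_pmf (biased_signs I \<theta> U) \<bind> W)) = (\<integral>y. m U y * f y \<partial>\<mu>)" .
  qed
  have mix: "measure_pmf (biased_signs I \<theta> U) \<bind> W \<in> space (prob_algebra N)" for U
    using prob_space_bind'[of "measure_pmf (biased_signs I \<theta> U)" "count_space UNIV" W N]
      sets_bind'[of "measure_pmf (biased_signs I \<theta> U)" "count_space UNIV" W N] W
    by (auto simp: space_prob_algebra measure_pmf.prob_space_axioms)
  have int_m: "integrable \<mu> (m U)" and m1: "(\<integral>y. m U y \<partial>\<mu>) = 1" for U
    using integrable_m[of "\<lambda>_. 1" 1 U] integral_mix[of "\<lambda>_. 1" 1 U] mix[of U]
    by (auto simp: space_prob_algebra prob_space.prob_space)
  define z where "z i = (\<integral>y. exp (\<phi> i y) \<partial>(measure_pmf (biased_signs I \<theta> (flip V i)) \<bind> W))" for i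
  have z: "z i > 0" if "i \<in> I" for i
    unfolding z_def by (rule integral_exp_bounds(4)[OF mix \<phi>m[OF that] c[OF that]])
  \<comment> \<open>Normalised so that \<open>exp (u i y)\<close> has mean 1 under the mixture for
    \<open>flip V i\<close>; the logarithm in the definition of \<open>kl_sum_le\<close> then
    becomes linear.\<close>
  define u where "u i y = \<phi> i y - ln (z i)" for i y
  have int_um: "integrable \<mu> (\<lambda>y. m V y * u i y)"
    and integral_um: "(\<integral>y. m V y * u i y \<partial>\<mu>) = (\<integral>y. \<phi> i y \<partial>(measure_pmf (biased_signs I \<theta> V) \<bind> W)) - ln (z i)"
    if "i \<in> I" for i
  proof -
    have i: "integrable \<mu> (\<lambda>y. m V y * \<phi> i y)" by (rule integrable_m[OF \<phi>m[OF that] c[OF that]])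
    show "integrable \<mu> (\<lambda>y. m V y * u i y)"
      using i int_m by (simp add: u_def right_diff_distrib)
    show "(\<integral>y. m V y * u i y \<partial>\<mu>) = (\<integral>y. \<phi> i y \<partial>(measure_pmf (biased_signs I \<theta> V) \<bind> W)) - ln (z i)"
      using i int_m m1[of V] integral_mix[OF \<phi>m[OF that] c[OF that], of V]
      by (simp add: u_def right_diff_distrib)
  qed
  have int_em: "integrable \<mu> (\<lambda>y. exp (u i y) * m (flip V i) y)"
    and integral_em: "(\<integral>y. exp (u i y) * m (flip V i) y \<partial>\<mu>) = 1" if "i \<in> I" for i
  proof -
    have em: "(\<lambda>y. exp (\<phi> i y)) \<in> borel_measurable N"
      by (rule measurable_compose[OF \<phi>m[OF that] borel_measurable_exp])
    have eb: "\<bar>exp (\<phi> i y)\<bar> \<le> exp (c i)" if "y \<in> space N" for y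
      using c[OF \<open>i \<in> I\<close> that] by simp
    have eq: "exp (u i y) * m (flip V i) y = (m (flip V i) y * exp (\<phi> i y)) / z i" for y
      using z[OF that] by (simp add: u_def exp_diff mult_ac)
    show "integrable \<mu> (\<lambda>y. exp (u i y) * m (flip V i) y)"
      unfolding eq using integrable_m[OF em eb] by simp
    show "(\<integral>y. exp (u i y) * m (flip V i) y \<partial>\<mu>) = 1"
      unfolding eq using integral_mix[OF em eb, of "flip V i"] z[OF that] by (simp add: z_def)
  qed
  define K where "K = 4 * \<theta>\<^sup>2 / (1 - \<theta>\<^sup>2) * (e - 1)\<^sup>2"
  have pointwise: "AE y in \<mu>. (\<Sum>i\<in>I. m V y * u i y - exp (u i y) * m (flip V i) y + m (flip V i) y) \<le> K * m V y"
    using ae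
  proof eventually_elim
    case (elim y)
    have low: "w s y \<le> e * m U y" if "s \<in> ?F" for s U
    proof -
      have "measure_pmf.expectation (biased_signs I \<theta> U) (\<lambda>_. w s y)
          \<le> measure_pmf.expectation (biased_signs I \<theta> U) (\<lambda>s'. e * w s' y)"
        using elim that set_pmf_biased_signs[OF I \<theta>, of U]
        by (intro integral_mono_AE integrable_biased_signs[OF I \<theta>]) (auto simp: AE_measure_pmf_iff)
      then show ?thesis by (simp add: m_def)
    qed
    show ?case
    \<comment> \<open>If one density is positive at \<open>y\<close>, then \<open>low\<close> makes
      every mixture positive there; otherwise all mixtures vanish and both sides are 0.\<close>
    proof (cases "\<exists>s\<in>?F. 0 < w s y")
      case True
      then obtain s where s: "s \<in> ?F" "0 < w s y" by blast
      have pos: "0 < m U y" for U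
      proof -
        have "0 < e * m U y" using low[OF s(1), of U] s(2) by linarith
        with e show ?thesis by (simp add: zero_less_mult_iff)
      qed
      have "(\<Sum>i\<in>I. m V y * u i y - exp (u i y) * m (flip V i) y + m (flip V i) y)
          \<le> (\<Sum>i\<in>I. (m V y - m (flip V i) y)\<^sup>2 / m (flip V i) y)"
      proof (rule sum_mono)
        fix i
        show "m V y * u i y - exp (u i y) * m (flip V i) y + m (flip V i) y
            \<le> (m V y - m (flip V i) y)\<^sup>2 / m (flip V i) y"
          using log_likelihood_test_le[OF pos[of V] pos[of "flip V i"], of "u i y"] by (simp add: mult.commute)
      qed
      also have "\<dots> \<le> K * m V y"
        unfolding m_def K_def by (rule chi_square_biased_signs[OF I \<theta>]) (use elim w0 in auto)
      finally show ?thesis .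
    next
      case False
      then have "m U y = 0" for U unfolding m_sum using w0[of _ y] by (force intro!: sum.neutral simp: order_le_less)
      then show ?thesis by simp
    qed
  qed
  \<comment> \<open>The two extra terms under the integral contribute \<open>-1\<close> and
    \<open>+1\<close> for each \<open>i\<close>, so they cancel.\<close>
  have "(\<Sum>i\<in>I. (\<integral>y. \<phi> i y \<partial>(measure_pmf (biased_signs I \<theta> V) \<bind> W)) - ln (z i))
      = (\<integral>y. (\<Sum>i\<in>I. m V y * u i y - exp (u i y) * m (flip V i) y + m (flip V i) y) \<partial>\<mu>)"
    using int_um int_em int_m
    by (subst Bochner_Integration.integral_sum) (auto simp: integral_um integral_em m1 intro!: sum.cong)
  also have "\<dots> \<le> (\<integral>y. K * m V y \<partial>\<mu>)"
    using int_um int_em int_m by (intro integral_mono_AE pointwise) auto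
  also have "\<dots> = K" using m1 int_m by simp
  finally show "(\<Sum>i\<in>I. (\<integral>y. \<phi> i y \<partial>(measure_pmf (biased_signs I \<theta> V) \<bind> W))
     - ln (\<integral>y. exp (\<phi> i y) \<partial>(measure_pmf (biased_signs I \<theta> (flip V i)) \<bind> W)))
      \<le> 4 * \<theta>\<^sup>2 / (1 - \<theta>\<^sup>2) * (e - 1)\<^sup>2"
    by (simp add: z_def K_def)
qed

subsection \<open>The interaction of algorithm and oracle\<close>

text \<open>The query point is not an argument, since a linear objective has the same gradient
  everywhere.\<close>

definition sign_oracle :: "real \<Rightarrow> real \<Rightarrow> 'a::euclidean_space set \<Rightarrow> 'a measure" where
  "sign_oracle \<beta> \<theta> V = distr (measure_pmf (biased_signs Basis \<theta> V)) borel (\<lambda>s. \<beta> *\<^sub>R (\<Sum>b\<in>Basis. spin (s b) *\<^sub>R b))"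

lemma sign_oracle_prob [simp]: "sign_oracle \<beta> \<theta> V \<in> space (prob_algebra borel)"
  unfolding sign_oracle_def by (auto simp: space_prob_algebra intro!: measure_pmf.prob_space_distr)

lemma space_HM [simp]: "space HM = UNIV"
  by (auto simp: HM_def space_PiM)

text \<open>One step of \<open>run\<close> as a Markov kernel on histories, the form to which the
  chain rule applies.\<close>

definition round_kernel where
  "round_kernel Q S Orc t h = Q t h \<bind> (\<lambda>x. Orc x \<bind> (\<lambda>g.
      S t (\<lambda>i. snd (h i)) g \<bind> (\<lambda>y. return HM (h(t := (x, y))))))"

text \<open>The nesting of pairs follows the order of sampling in a round: history, query, oracle
  answer, channel output.\<close>

lemma measurable_append:
  fixes t :: nat
  shows "(\<lambda>(((h, x), g), y). h(t := (x, y)))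
     \<in> ((HM \<Otimes>\<^sub>M borel) \<Otimes>\<^sub>M borel) \<Otimes>\<^sub>M borel \<rightarrow>\<^sub>M (HM :: (nat \<Rightarrow> 'a::euclidean_space \<times> 'a) measure)"
  unfolding HM_def split_beta' by (intro measurable_fun_upd[where J = UNIV]) (auto intro!: borel_measurable_Pair)

lemma measurable_return_append:
  "(\<lambda>y. return HM (h(t := (x, y)))) \<in> borel \<rightarrow>\<^sub>M prob_algebra (HM :: (nat \<Rightarrow> 'a::euclidean_space \<times> 'a) measure)"
proof -
  \<comment> \<open>The slot filled by \<open>undefined\<close> is that of the oracle answer; the
    history records only \<open>(x, y)\<close>.\<close>
  have "(\<lambda>y. (((h, x), undefined), y)) \<in> borel \<rightarrow>\<^sub>M ((HM \<Otimes>\<^sub>M borel) \<Otimes>\<^sub>M borel) \<Otimes>\<^sub>M borel"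
    by (intro measurable_Pair measurable_const) (auto simp: space_pair_measure)
  from measurable_compose[OF this measurable_append]
  have "(\<lambda>y. h(t := (x, y))) \<in> borel \<rightarrow>\<^sub>M (HM :: (nat \<Rightarrow> 'a \<times> 'a) measure)" by simp
  from measurable_compose[OF this measurable_return_prob_space] show ?thesis .
qed

lemma measurable_round_kernel:
  assumes Q: "Q t \<in> HM \<rightarrow>\<^sub>M prob_algebra borel"
    and S: "S \<in> valid_strategy \<epsilon>"
    and Orc: "Orc \<in> borel \<rightarrow>\<^sub>M prob_algebra borel"
  shows "round_kernel Q S Orc t \<in> HM \<rightarrow>\<^sub>M prob_algebra HM"
proof -
  have S': "(\<lambda>(h, g). S t (\<lambda>i. snd (h i)) g) \<in> (HM \<Otimes>\<^sub>M borel) \<rightarrow>\<^sub>M prob_algebra borel"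
    using S by (auto simp: valid_strategy_def)
  have a: "(\<lambda>((h, x), g). S t (\<lambda>i. snd (h i)) g) \<in> (HM \<Otimes>\<^sub>M borel) \<Otimes>\<^sub>M borel \<rightarrow>\<^sub>M prob_algebra borel"
  proof -
    have "(\<lambda>p. (fst (fst p), snd p)) \<in> (HM \<Otimes>\<^sub>M borel) \<Otimes>\<^sub>M borel \<rightarrow>\<^sub>M HM \<Otimes>\<^sub>M borel" by measurable
    from measurable_compose[OF this S'] show ?thesis by (simp add: split_beta')
  qed
  have b: "(\<lambda>(h, x). Orc x) \<in> HM \<Otimes>\<^sub>M borel \<rightarrow>\<^sub>M prob_algebra borel"
    using measurable_compose[OF measurable_snd Orc] by (simp add: split_beta')
  have c: "(\<lambda>(((h, x), g), y). return HM (h(t := (x, y))))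
     \<in> ((HM \<Otimes>\<^sub>M borel) \<Otimes>\<^sub>M borel) \<Otimes>\<^sub>M borel \<rightarrow>\<^sub>M prob_algebra HM"
    using measurable_compose[OF measurable_append measurable_return_prob_space, of t] by (simp add: split_beta')
  have d: "(\<lambda>((h, x), g). S t (\<lambda>i. snd (h i)) g \<bind> (\<lambda>y. return HM (h(t := (x, y)))))
      \<in> (HM \<Otimes>\<^sub>M borel) \<Otimes>\<^sub>M borel \<rightarrow>\<^sub>M prob_algebra HM"
    unfolding split_beta'
    by (rule measurable_bind_prob_space2) (use a c in \<open>simp_all add: split_beta'\<close>)
  have e: "(\<lambda>(h, x). Orc x \<bind> (\<lambda>g. S t (\<lambda>i. snd (h i)) g \<bind> (\<lambda>y. return HM (h(t := (x, y))))))
      \<in> HM \<Otimes>\<^sub>M borel \<rightarrow>\<^sub>M prob_algebra HM"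
    unfolding split_beta'
    by (rule measurable_bind_prob_space2) (use b d in \<open>simp_all add: split_beta'\<close>)
  show ?thesis
    unfolding round_kernel_def
    by (rule measurable_bind_prob_space2[OF Q]) (use e in simp)
qed

lemma run_Suc: "run Q S Orc (Suc t) = run Q S Orc t \<bind> round_kernel Q S Orc t"
  unfolding run.simps round_kernel_def[abs_def] ..

lemma bind_space_prob_algebra:
  assumes "P \<in> space (prob_algebra M)" "\<kappa> \<in> M \<rightarrow>\<^sub>M prob_algebra N"
  shows "P \<bind> \<kappa> \<in> space (prob_algebra N)"
  using prob_space_bind'[OF assms] sets_bind'[OF assms] by (simp add: space_prob_algebra)

lemma run_space_prob_algebra:
  assumes "\<And>t. Q t \<in> HM \<rightarrow>\<^sub>M prob_algebra borel" "S \<in> valid_strategy \<epsilon>" "Orc \<in> borel \<rightarrow>\<^sub>M prob_algebra borel"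
  shows "run Q S Orc t \<in> space (prob_algebra HM)"
proof (induction t)
  case 0
  then show ?case by (auto simp: space_prob_algebra prob_space_return)
next
  case (Suc t)
  then show ?case unfolding run_Suc
    by (rule bind_space_prob_algebra) (rule measurable_round_kernel[of Q t S \<epsilon> Orc, OF assms])
qed

text \<open>Embedding the sign vectors as vertices before the channel gives a channel on sign
  vectors with the same privacy ratio \<open>exp \<epsilon>\<close>.\<close>

lemma kl_sum_le_channel:
  fixes V :: "'a::euclidean_space set"
  assumes \<theta>: "0 < \<theta>" "\<theta> < 1" and W: "ldp_channel \<epsilon> W" "W \<in> borel \<rightarrow>\<^sub>M prob_algebra borel"
  shows "kl_sum_le borel Basis (sign_oracle \<beta> \<theta> V \<bind> W) (\<lambda>i. sign_oracle \<beta> \<theta> (flip V i) \<bind> W)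
    (4 * \<theta>\<^sup>2 / (1 - \<theta>\<^sup>2) * (exp \<epsilon> - 1)\<^sup>2)"
proof -
  have "sign_oracle \<beta> \<theta> U \<bind> W
     = measure_pmf (biased_signs Basis \<theta> U) \<bind> (\<lambda>s. W (\<beta> *\<^sub>R (\<Sum>b\<in>Basis. spin (s b) *\<^sub>R b)))" for U :: "'a set"
    unfolding sign_oracle_def by (rule bind_distr) (use W(2) in \<open>auto dest: measurable_prob_algebraD\<close>)
  then show ?thesis
    using W(1) by (simp only:) (rule kl_sum_le_biased_signs[OF finite_Basis \<theta>]; simp add: ldp_channel_def)
qed

text \<open>Induction with the chain rule. Given the history, the channel is a fixed private one
  even for an adaptive strategy, so each round adds the cost of one channel use.\<close>

lemma kl_sum_le_run:
  fixes V :: "'a::euclidean_space set"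
  assumes Q: "\<And>t. Q t \<in> HM \<rightarrow>\<^sub>M prob_algebra borel" and S: "S \<in> valid_strategy \<epsilon>"
    and \<theta>: "0 < \<theta>" "\<theta> < 1"
  shows "kl_sum_le HM Basis (run Q S (\<lambda>_. sign_oracle \<beta> \<theta> V) t)
    (\<lambda>i. run Q S (\<lambda>_. sign_oracle \<beta> \<theta> (flip V i)) t) (real t * (4 * \<theta>\<^sup>2 / (1 - \<theta>\<^sup>2) * (exp \<epsilon> - 1)\<^sup>2))"
proof (induction t)
  case 0
  have "return HM (\<lambda>_. (0 :: 'a, 0 :: 'a)) \<in> space (prob_algebra HM)"
    by (auto simp: space_prob_algebra prob_space_return)
  from kl_sum_le_refl[OF this] show ?case by simp
next
  case (Suc t)
  let ?K = "4 * \<theta>\<^sup>2 / (1 - \<theta>\<^sup>2) * (exp \<epsilon> - 1)\<^sup>2"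
  let ?O = "sign_oracle \<beta> \<theta>"
  have kern: "round_kernel Q S (\<lambda>_. ?O U) t \<in> HM \<rightarrow>\<^sub>M prob_algebra HM" for U :: "'a set"
    by (rule measurable_round_kernel[OF Q S]) simp
  have one: "kl_sum_le HM Basis (round_kernel Q S (\<lambda>_. ?O V) t h) (\<lambda>i. round_kernel Q S (\<lambda>_. ?O (flip V i)) t h) ?K" for h
  proof -
    define W where "W = S t (\<lambda>i. snd (h i))"
    define ret where "ret x y = return HM (h(t := (x, y)))" for x y
    have ldp: "ldp_channel \<epsilon> W" using S by (auto simp: valid_strategy_def W_def)
    have "(\<lambda>g. (h, g)) \<in> borel \<rightarrow>\<^sub>M HM \<Otimes>\<^sub>M borel" by measurable
    moreover have "(\<lambda>(h, g). S t (\<lambda>i. snd (h i)) g) \<in> (HM \<Otimes>\<^sub>M borel) \<rightarrow>\<^sub>M prob_algebra borel"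
      using S by (auto simp: valid_strategy_def)
    ultimately have "(\<lambda>g. case (h, g) of (h, g) \<Rightarrow> S t (\<lambda>i. snd (h i)) g) \<in> borel \<rightarrow>\<^sub>M prob_algebra borel"
      by (rule measurable_compose)
    then have W: "W \<in> borel \<rightarrow>\<^sub>M prob_algebra borel" by (simp add: W_def)
    have ret: "ret x \<in> borel \<rightarrow>\<^sub>M prob_algebra HM" for x
      unfolding ret_def by (rule measurable_return_append)
    have Qh: "Q t h \<in> space (prob_algebra borel)" using measurable_space[OF Q] by simp
    \<comment> \<open>Reassociation turns a round into three stages, query, channel output and
      recording, of which only the middle one depends on \<open>U\<close>.\<close>
    have round_eq: "round_kernel Q S (\<lambda>_. ?O U) t h = Q t h \<bind> (\<lambda>x. (?O U \<bind> W) \<bind> ret x)" for U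
    proof -
      have "?O U \<bind> (\<lambda>g. W g \<bind> ret x) = (?O U \<bind> W) \<bind> ret x" for x
        by (rule bind_assoc[symmetric, where N = borel and R = HM])
          (simp_all add: measurable_cong_sets[of "?O U" borel] sign_oracle_def measurable_prob_algebraD W ret)
      moreover have "ret x = (\<lambda>y. return HM (h(t := (x, y))))" for x
        by (rule ext) (rule ret_def)
      ultimately show ?thesis by (simp only: round_kernel_def W_def)
    qed
    have OW: "?O U \<bind> W \<in> space (prob_algebra borel)" for U
      by (rule bind_space_prob_algebra[OF sign_oracle_prob W])
    have meas: "(\<lambda>x. (?O U \<bind> W) \<bind> ret x) \<in> borel \<rightarrow>\<^sub>M prob_algebra HM" for U
    proof (rule measurable_bind_prob_space2)
      show "(\<lambda>_. ?O U \<bind> W) \<in> borel \<rightarrow>\<^sub>M prob_algebra borel" using OW by simp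
      have "(\<lambda>p. (((h, fst p), undefined), snd p)) \<in> borel \<Otimes>\<^sub>M borel \<rightarrow>\<^sub>M ((HM \<Otimes>\<^sub>M borel) \<Otimes>\<^sub>M borel) \<Otimes>\<^sub>M borel"
        by (intro measurable_Pair measurable_const) (auto simp: space_pair_measure)
      from measurable_compose[OF measurable_compose[OF this measurable_append] measurable_return_prob_space]
      show "(\<lambda>(x, y). ret x y) \<in> borel \<Otimes>\<^sub>M borel \<rightarrow>\<^sub>M prob_algebra HM" by (simp add: ret_def split_beta')
    qed
    have inner: "kl_sum_le HM Basis ((?O V \<bind> W) \<bind> ret x) (\<lambda>i. (?O (flip V i) \<bind> W) \<bind> ret x) (?K + 0)" for x
      by (rule kl_sum_le_bind[OF OW OW ret ret kl_sum_le_channel[OF \<theta> ldp W] kl_sum_le_refl])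
        (rule measurable_space[OF ret])
    have "kl_sum_le HM Basis (Q t h \<bind> (\<lambda>x. (?O V \<bind> W) \<bind> ret x))
        (\<lambda>i. Q t h \<bind> (\<lambda>x. (?O (flip V i) \<bind> W) \<bind> ret x)) (0 + (?K + 0))"
      by (rule kl_sum_le_bind[OF Qh Qh meas meas kl_sum_le_refl[OF Qh] inner])
    then show ?thesis unfolding round_eq by simp
  qed
  have "kl_sum_le HM Basis (run Q S (\<lambda>_. ?O V) t \<bind> round_kernel Q S (\<lambda>_. ?O V) t)
    (\<lambda>i. run Q S (\<lambda>_. ?O (flip V i)) t \<bind> round_kernel Q S (\<lambda>_. ?O (flip V i)) t) (real t * ?K + ?K)"
    by (rule kl_sum_le_bind[OF run_space_prob_algebra[OF Q S] run_space_prob_algebra[OF Q S] kern kern Suc one]) simp_all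
  moreover have "real (Suc t) * ?K = real t * ?K + ?K" by (simp only: of_nat_Suc distrib_right mult_1_left)
  ultimately show ?case by (simp only: run_Suc)
qed

subsection \<open>From relative entropies to expectations\<close>

lemma exp_le_quadratic:
  fixes x :: real
  assumes "\<bar>x\<bar> \<le> 1"
  shows "exp x \<le> 1 + x + x\<^sup>2"
proof (cases "0 \<le> x")
  case True
  then show ?thesis using assms by (intro exp_bound) auto
next
  case False
  define y where "y = - x"
  have y: "0 < y" "y \<le> 1" using False assms by (auto simp: y_def)
  \<comment> \<open>The product is \<open>1 + y ^ 3\<close>.\<close>
  have "1 \<le> (1 - y + y\<^sup>2) * (1 + y)"
    using y by (simp add: power2_eq_square algebra_simps)
  also have "\<dots> \<le> (1 - y + y\<^sup>2) * exp y"
    using y exp_ge_add_one_self[of y] by (intro mult_left_mono) auto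
  finally have "exp (- y) * 1 \<le> exp (- y) * ((1 - y + y\<^sup>2) * exp y)" by (intro mult_left_mono) auto
  also have "\<dots> = 1 - y + y\<^sup>2" by (simp add: exp_minus)
  finally show ?thesis by (simp add: y_def)
qed

text \<open>Testing with \<open>\<psi> / 2\<close> and bounding exp quadratically costs
  \<open>1 / 4\<close> per index. The resulting term \<open>card I / 2\<close> is affordable, as the
  trivial bound on the left side is \<open>2 * card I\<close>.\<close>

lemma kl_sum_le_imp_expectation_diff:
  assumes I: "finite I" and P: "P \<in> space (prob_algebra M)"
    and R: "\<And>i. i \<in> I \<Longrightarrow> R i \<in> space (prob_algebra M)"
    and kl: "kl_sum_le M I P R C"
    and \<psi>: "\<And>i. i \<in> I \<Longrightarrow> \<psi> i \<in> borel_measurable M" "\<And>i x. i \<in> I \<Longrightarrow> x \<in> space M \<Longrightarrow> \<bar>\<psi> i x\<bar> \<le> (1 :: real)"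
  shows "(\<Sum>i\<in>I. (\<integral>x. \<psi> i x \<partial>P) - (\<integral>x. \<psi> i x \<partial>R i)) \<le> 2 * C + real (card I) / 2"
proof -
  define \<phi> where "\<phi> i x = \<psi> i x / 2" for i x
  have \<phi>m: "\<phi> i \<in> borel_measurable M" if "i \<in> I" for i
    unfolding \<phi>_def using \<psi>(1)[OF that] by simp
  have \<phi>b: "\<bar>\<phi> i x\<bar> \<le> 1 / 2" if "i \<in> I" "x \<in> space M" for i x
    unfolding \<phi>_def using \<psi>(2)[OF that] by simp
  have "((\<integral>x. \<psi> i x \<partial>P) - (\<integral>x. \<psi> i x \<partial>R i)) / 2 - 1 / 4
      \<le> (\<integral>x. \<phi> i x \<partial>P) - ln (\<integral>x. exp (\<phi> i x) \<partial>R i)" if i: "i \<in> I" for i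
  proof -
    have sR: "sets (R i) = sets M" "prob_space (R i)" using R[OF i] by (auto simp: space_prob_algebra)
    interpret R: prob_space "R i" by fact
    note ex = integral_exp_bounds[OF R[OF i] \<phi>m[OF i] \<phi>b[OF i]]
    have int: "integrable (R i) (\<phi> i)" by (rule integrable_prob_algebra_bounded[OF R[OF i] \<phi>m[OF i] \<phi>b[OF i]])
    have "(\<integral>x. exp (\<phi> i x) \<partial>R i) \<le> (\<integral>x. 5 / 4 + \<phi> i x \<partial>R i)"
    proof (rule integral_mono)
      fix x assume "x \<in> space (R i)"
      then have b: "\<bar>\<phi> i x\<bar> \<le> 1 / 2" using \<phi>b[OF i] sets_eq_imp_space_eq[OF sR(1)] by simp
      then have "\<bar>\<phi> i x\<bar>\<^sup>2 \<le> (1 / 2)\<^sup>2" by (intro power_mono) auto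
      then have "(\<phi> i x)\<^sup>2 \<le> 1 / 4" by (simp add: power2_eq_square)
      then show "exp (\<phi> i x) \<le> 5 / 4 + \<phi> i x" using exp_le_quadratic[of "\<phi> i x"] b by simp
    qed (use int ex in auto)
    also have "\<dots> = 5 / 4 + (\<integral>x. \<phi> i x \<partial>R i)" using int by (simp add: R.prob_space)
    finally have "ln (\<integral>x. exp (\<phi> i x) \<partial>R i) \<le> 1 / 4 + (\<integral>x. \<phi> i x \<partial>R i)"
      using ln_le_minus_one[OF ex(4)] by simp
    then show ?thesis by (simp add: \<phi>_def field_simps)
  qed
  then have "(\<Sum>i\<in>I. ((\<integral>x. \<psi> i x \<partial>P) - (\<integral>x. \<psi> i x \<partial>R i)) / 2 - 1 / 4)
      \<le> (\<Sum>i\<in>I. (\<integral>x. \<phi> i x \<partial>P) - ln (\<integral>x. exp (\<phi> i x) \<partial>R i))"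
    by (rule sum_mono)
  also have "\<dots> \<le> C" using kl \<phi>m \<phi>b unfolding kl_sum_le_def by blast
  finally show ?thesis
    by (simp add: sum_subtractf[where f = "\<lambda>i. _ i / 2"] flip: sum_divide_distrib)
qed

section \<open>Averaging over all sign patterns\<close>

lemma flip_flip: "flip (flip V i) i = V"
  by (auto simp: flip_def)

lemma flip_subset: "i \<in> I \<Longrightarrow> V \<subseteq> I \<Longrightarrow> flip V i \<subseteq> I"
  by (auto simp: flip_def)

text \<open>Flipping \<open>i\<close> is an involution on the patterns that negates
  \<open>spin (i \<in> V)\<close>. Summed over all patterns, both terms of the hypothesis therefore
  agree, so the average over \<open>V\<close> of the sum in the conclusion is at least
  \<open>- C\<close>.\<close>

lemma exists_sign_pattern:
  fixes A :: "'i set \<Rightarrow> 'i \<Rightarrow> real"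
  assumes I: "finite I"
    and le: "\<And>V. V \<subseteq> I \<Longrightarrow> (\<Sum>i\<in>I. - spin (i \<in> V) * A V i + spin (i \<in> V) * A (flip V i) i) \<le> 2 * C"
  shows "\<exists>V\<subseteq>I. - C \<le> (\<Sum>i\<in>I. spin (i \<in> V) * A V i)"
proof (rule ccontr)
  assume "\<not> ?thesis"
  then have less: "(\<Sum>i\<in>I. spin (i \<in> V) * A V i) < - C" if "V \<subseteq> I" for V
    using that by (simp add: not_le)
  let ?s = "\<Sum>V\<in>Pow I. \<Sum>i\<in>I. spin (i \<in> V) * A V i"
  have "(\<Sum>V\<in>Pow I. \<Sum>i\<in>I. spin (i \<in> V) * A (flip V i) i) = (\<Sum>i\<in>I. \<Sum>V\<in>Pow I. spin (i \<in> V) * A (flip V i) i)"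
    by (rule sum.swap)
  also have "\<dots> = (\<Sum>i\<in>I. \<Sum>V\<in>Pow I. - (spin (i \<in> V) * A V i))"
  proof (rule sum.cong[OF refl])
    fix i assume i: "i \<in> I"
    show "(\<Sum>V\<in>Pow I. spin (i \<in> V) * A (flip V i) i) = (\<Sum>V\<in>Pow I. - (spin (i \<in> V) * A V i))"
      by (rule sum.reindex_bij_witness[where i = "\<lambda>V. flip V i" and j = "\<lambda>V. flip V i"])
        (simp_all add: flip_flip spin_flip flip_subset i)
  qed
  also have "\<dots> = - ?s" by (subst sum.swap) (simp add: sum_negf)
  finally have "(\<Sum>V\<in>Pow I. \<Sum>i\<in>I. - spin (i \<in> V) * A V i + spin (i \<in> V) * A (flip V i) i) = - 2 * ?s"
    by (simp add: sum.distrib sum_negf sum_subtractf)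
  moreover have "(\<Sum>V\<in>Pow I. \<Sum>i\<in>I. - spin (i \<in> V) * A V i + spin (i \<in> V) * A (flip V i) i)
      \<le> (\<Sum>V\<in>Pow I. 2 * C)"
    using le by (intro sum_mono) auto
  moreover have "(\<Sum>V\<in>Pow I. 2 * C) = - 2 * (\<Sum>V\<in>Pow I. - C)"
    by (simp only: sum_negf sum_distrib_left[symmetric])
  moreover have "?s < (\<Sum>V\<in>Pow I. - C)"
    using I less by (intro sum_strict_mono) auto
  ultimately show False by linarith
qed

section \<open>Norm estimates and admissibility of the hard instances\<close>

lemma lpnorm_nonneg: "0 \<le> lpnorm p x"
proof -
  obtain b :: 'a where b: "b \<in> Basis" using nonempty_Basis by blast
  have "0 \<le> Max ((\<lambda>b. \<bar>x \<bullet> b\<bar>) ` Basis)"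
    using b by (intro order_trans[OF abs_ge_zero[of "x \<bullet> b"] Max_ge]) auto
  then show ?thesis by (simp add: lpnorm_def)
qed

lemma lpnorm_le:
  fixes x :: "'a::euclidean_space"
  assumes "0 < q" "0 \<le> c" "\<And>b. b \<in> Basis \<Longrightarrow> \<bar>x \<bullet> b\<bar> \<le> c"
  shows "lpnorm (ereal q) x \<le> real DIM('a) powr (1 / q) * c"
proof -
  have "(\<Sum>b\<in>Basis. \<bar>x \<bullet> b\<bar> powr q) \<le> (\<Sum>b\<in>(Basis :: 'a set). c powr q)"
    using assms by (intro sum_mono powr_mono2) auto
  then have "lpnorm (ereal q) x \<le> (real DIM('a) * c powr q) powr (1 / q)"
    using assms(1) by (auto simp: lpnorm_def intro!: powr_mono2 sum_nonneg)
  also have "\<dots> = real DIM('a) powr (1 / q) * c"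
    using assms by (simp add: powr_mult powr_powr)
  finally show ?thesis .
qed

lemma lpnorm_hconj_le:
  fixes x :: "'a::euclidean_space"
  assumes p: "1 \<le> p" and "0 \<le> c" "\<And>b. b \<in> Basis \<Longrightarrow> \<bar>x \<bullet> b\<bar> \<le> c"
  shows "lpnorm (hconj p) x \<le> real DIM('a) powr (1 - 1 / p) * c"
proof (cases "p = 1")
  case True
  then show ?thesis using assms by (simp add: hconj_def lpnorm_def)
next
  case False
  then have "1 / (p / (p - 1)) = 1 - 1 / p" using p by (simp add: field_simps)
  then show ?thesis
    using lpnorm_le[of "p / (p - 1)" c x] assms False by (simp add: hconj_def)
qed

text \<open>By convexity, exp lies below its chord over the unit interval.\<close>

lemma exp_minus_one_le:
  fixes \<epsilon> :: real
  assumes "0 \<le> \<epsilon>" "\<epsilon> \<le> 1"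
  shows "exp \<epsilon> - 1 \<le> (exp 1 - 1) * \<epsilon>"
proof -
  have "exp \<epsilon> \<le> 1 - \<epsilon> + \<epsilon> * exp 1"
    using convex_onD[OF exp_convex, of \<epsilon> 0 1] assms by simp
  then show ?thesis by (simp only: algebra_simps)
qed

text \<open>The scale \<open>\<beta>\<close> is chosen so that
  \<open>real DIM('a) powr (1 - 1 / p) * \<beta> = B\<close>, which bounds the dual norm of every
  vertex by \<open>B\<close>. The mean of the oracle is the gradient of the linear
  objective.\<close>

lemma sign_oracle_in_oracle_class:
  fixes X :: "'a::euclidean_space set"
  assumes p: "1 \<le> p" and B: "0 \<le> B" and X: "convex X" and \<theta>: "0 < \<theta>" "\<theta> < 1"
  defines "\<beta> \<equiv> B * real DIM('a) powr (1 / p - 1)"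
  shows "(\<lambda>x. (\<Sum>b\<in>Basis. (\<theta> * \<beta> * spin (b \<in> V)) *\<^sub>R b) \<bullet> x, \<lambda>_. sign_oracle \<beta> \<theta> V) \<in> oracle_class p B X"
proof -
  define v :: 'a where "v = (\<Sum>b\<in>Basis. (\<theta> * \<beta> * spin (b \<in> V)) *\<^sub>R b)"
  define pt :: "('a \<Rightarrow> bool) \<Rightarrow> 'a" where "pt s = \<beta> *\<^sub>R (\<Sum>b\<in>Basis. spin (s b) *\<^sub>R b)" for s
  have \<beta>: "0 \<le> \<beta>" using B by (simp add: \<beta>_def)
  have or: "sign_oracle \<beta> \<theta> V = distr (measure_pmf (biased_signs Basis \<theta> V)) borel pt"
    by (simp add: sign_oracle_def pt_def[abs_def])
  note int = integrable_biased_signs[OF finite_Basis \<theta>]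
  have "(\<integral>g. g \<partial>sign_oracle \<beta> \<theta> V) = measure_pmf.expectation (biased_signs Basis \<theta> V) pt"
    unfolding or by (rule integral_distr) auto
  also have "\<dots> = \<beta> *\<^sub>R (\<Sum>b\<in>Basis. measure_pmf.expectation (biased_signs Basis \<theta> V) (\<lambda>s. spin (s b)) *\<^sub>R b)"
    unfolding pt_def by (simp add: int)
  also have "\<dots> = v"
    using expectation_component[OF finite_Basis \<theta>, of _ V spin]
    by (simp add: v_def scaleR_sum_right spin_def[of True] spin_def[of False] mult_ac field_simps cong: sum.cong)
  finally have mean: "(\<integral>g. g \<partial>sign_oracle \<beta> \<theta> V) = v" .
  have norm: "(lpnorm (hconj p) (pt s))\<^sup>2 \<le> B\<^sup>2" for s
  proof (rule power_mono[OF _ lpnorm_nonneg])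
    have "lpnorm (hconj p) (pt s) \<le> real DIM('a) powr (1 - 1 / p) * \<beta>"
      using \<beta> by (intro lpnorm_hconj_le[OF p]) (auto simp: pt_def spin_def abs_mult)
    also have "\<dots> = B" by (simp add: \<beta>_def powr_add[symmetric] mult.left_commute)
    finally show "lpnorm (hconj p) (pt s) \<le> B" .
  qed
  \<comment> \<open>A finite set is Borel, so the almost sure statement passes through
    \<open>distr\<close> without any measurability of the norm.\<close>
  have "finite (pt ` sign_vectors Basis)" by (intro finite_imageI finite_sign_vectors[OF finite_Basis \<theta>])
  then have "pt ` sign_vectors Basis \<in> sets borel" by (intro borel_closed finite_imp_closed)
  then have "AE g in sign_oracle \<beta> \<theta> V. g \<in> pt ` sign_vectors Basis"
    unfolding or using set_pmf_biased_signs[OF finite_Basis \<theta>, of V]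
    by (subst AE_distr_iff) (auto simp: AE_measure_pmf_iff)
  then have "AE g in sign_oracle \<beta> \<theta> V. (lpnorm (hconj p) g)\<^sup>2 \<le> B\<^sup>2"
    by eventually_elim (use norm in auto)
  moreover have "integrable (sign_oracle \<beta> \<theta> V) (\<lambda>g. g)"
    unfolding or by (subst integrable_distr_eq) (auto intro: int)
  moreover have "v \<in> subgrad (\<lambda>x. v \<bullet> x) X x" for x
    by (simp add: subgrad_def inner_diff_right)
  moreover have "convex_on X (\<lambda>x. v \<bullet> x)"
    using X by (intro convex_onI) (auto simp: inner_add_right)
  moreover have "(\<lambda>x. v \<bullet> x) \<in> borel_measurable borel" by measurable
  moreover have "(\<lambda>_. sign_oracle \<beta> \<theta> V) \<in> borel \<rightarrow>\<^sub>M prob_algebra borel" by simp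
  ultimately show ?thesis
    unfolding oracle_class_def v_def[symmetric] mem_Collect_eq case_prod_conv mean by blast
qed

subsection \<open>The lower bound\<close>

text \<open>Test functions must be bounded on the whole space, whereas outputs lie in the cube only
  almost surely; on the cube, clipping the rescaled coordinates changes nothing.\<close>

definition clip :: "real \<Rightarrow> real" where
  "clip y = max (- 1) (min 1 y)"

lemma clip_eq: "\<bar>y\<bar> \<le> 1 \<Longrightarrow> clip y = y"
  by (auto simp: clip_def)

text \<open>The output is post-processing of the history and costs nothing. With information at most
  \<open>d / 4\<close>, where \<open>d\<close> is the dimension, the differences of expectations sum
  to at most \<open>2 * d / 4 + d / 2 = d\<close>, and averaging over patterns halves this.\<close>

lemma exists_unlearned_sign_pattern:
  fixes Q :: "nat \<Rightarrow> (nat \<Rightarrow> 'a \<times> 'a) \<Rightarrow> 'a::euclidean_space measure"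
  assumes Q: "\<And>t. Q t \<in> HM \<rightarrow>\<^sub>M prob_algebra borel" and Out: "Out \<in> HM \<rightarrow>\<^sub>M prob_algebra borel"
    and S: "S \<in> valid_strategy \<epsilon>" and \<theta>: "0 < \<theta>" "\<theta> < 1"
    and K: "real T * (4 * \<theta>\<^sup>2 / (1 - \<theta>\<^sup>2) * (exp \<epsilon> - 1)\<^sup>2) \<le> real DIM('a) / 4"
  shows "\<exists>V\<subseteq>(Basis :: 'a set). - (real DIM('a) / 2) \<le> (\<Sum>b\<in>Basis. spin (b \<in> V) *
    (\<integral>x. clip (x \<bullet> b / r) \<partial>(run Q S (\<lambda>_. sign_oracle \<beta> \<theta> V) T \<bind> Out)))"
proof (rule exists_sign_pattern[OF finite_Basis])
  fix V :: "'a set"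
  let ?P = "\<lambda>V. run Q S (\<lambda>_. sign_oracle \<beta> \<theta> V) T \<bind> Out"
  let ?A = "\<lambda>V b. \<integral>x. clip (x \<bullet> b / r) \<partial>?P V"
  have run: "run Q S (\<lambda>_. sign_oracle \<beta> \<theta> U) T \<in> space (prob_algebra HM)" for U :: "'a set"
    by (rule run_space_prob_algebra[OF Q S]) simp
  have P: "?P U \<in> space (prob_algebra borel)" for U :: "'a set"
    by (rule bind_space_prob_algebra[OF run Out])
  have "kl_sum_le borel Basis (?P V) (\<lambda>b. ?P (flip V b)) (real T * (4 * \<theta>\<^sup>2 / (1 - \<theta>\<^sup>2) * (exp \<epsilon> - 1)\<^sup>2) + 0)"
    by (rule kl_sum_le_bind[OF run run Out Out kl_sum_le_run[OF Q S \<theta>] kl_sum_le_refl])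
      (rule measurable_space[OF Out])
  then have kl: "kl_sum_le borel Basis (?P V) (\<lambda>b. ?P (flip V b)) (real T * (4 * \<theta>\<^sup>2 / (1 - \<theta>\<^sup>2) * (exp \<epsilon> - 1)\<^sup>2))"
    by simp
  define \<psi> where "\<psi> b x = - spin (b \<in> V) * clip (x \<bullet> b / r)" for b x
  have "(\<Sum>b\<in>Basis. (\<integral>x. \<psi> b x \<partial>?P V) - (\<integral>x. \<psi> b x \<partial>?P (flip V b)))
      \<le> 2 * (real T * (4 * \<theta>\<^sup>2 / (1 - \<theta>\<^sup>2) * (exp \<epsilon> - 1)\<^sup>2)) + real (card (Basis :: 'a set)) / 2"
    by (rule kl_sum_le_imp_expectation_diff[OF finite_Basis P P kl])
      (auto simp: \<psi>_def clip_def spin_def)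
  also have "\<dots> \<le> 2 * (real DIM('a) / 2)" using K by simp
  finally show "(\<Sum>b\<in>Basis. - spin (b \<in> V) * ?A V b + spin (b \<in> V) * ?A (flip V b) b) \<le> 2 * (real DIM('a) / 2)"
    by (simp add: \<psi>_def)
qed

text \<open>On the cube the excess error is at least the sum over \<open>b\<close> of
  \<open>a * (r + spin (b \<in> V) * (x \<bullet> b))\<close>. Hypothesis \<open>V\<close> says that
  its mean keeps at least half of the value \<open>a * r * real DIM('a)\<close> attained at the
  centre.\<close>

lemma opt_error_lower_bound:
  fixes Q :: "nat \<Rightarrow> (nat \<Rightarrow> 'a \<times> 'a) \<Rightarrow> 'a::euclidean_space measure"
  assumes QO: "(Q, Out) \<in> valid_alg X" and S: "S \<in> valid_strategy \<epsilon>"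
    and Orc: "Orc \<in> borel \<rightarrow>\<^sub>M prob_algebra borel"
    and r: "0 < r" and a: "0 \<le> a"
    and X: "X = {x. \<forall>b\<in>Basis. \<bar>x \<bullet> b\<bar> \<le> r}"
    and V: "- (real DIM('a) / 2) \<le> (\<Sum>b\<in>Basis. spin (b \<in> V) *
      (\<integral>x. clip (x \<bullet> b / r) \<partial>(run Q S Orc T \<bind> Out)))"
  shows "ennreal (a * r * real DIM('a) / 2)
    \<le> opt_error (\<lambda>x. (\<Sum>b\<in>Basis. (a * spin (b \<in> V)) *\<^sub>R b) \<bullet> x) X Orc Q Out S T"
proof -
  define f where "f x = (\<Sum>b\<in>Basis. (a * spin (b \<in> V)) *\<^sub>R b) \<bullet> x" for x :: 'a
  have f: "f x = (\<Sum>b\<in>Basis. a * spin (b \<in> V) * (x \<bullet> b))" for x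
    unfolding f_def inner_sum_left by (simp add: inner_commute)
  have Q: "\<And>t. Q t \<in> HM \<rightarrow>\<^sub>M prob_algebra borel" and Out: "Out \<in> HM \<rightarrow>\<^sub>M prob_algebra borel"
    and OutX: "\<And>h. AE x in Out h. x \<in> X"
    using QO by (auto simp: valid_alg_def)
  define P where "P = run Q S Orc T \<bind> Out"
  have run: "run Q S Orc T \<in> space (prob_algebra HM)"
    by (rule run_space_prob_algebra[OF Q S Orc])
  have P: "P \<in> space (prob_algebra borel)"
    unfolding P_def by (rule bind_space_prob_algebra[OF run Out])
  then have sP: "sets P = sets borel" and pP: "prob_space P" by (auto simp: space_prob_algebra)
  interpret P: prob_space P by (rule pP)
  have sr: "sets (run Q S Orc T) = sets HM" using run by (simp add: space_prob_algebra)
  have X': "X = (\<Inter>b\<in>Basis. {x. \<bar>x \<bullet> b\<bar> \<le> r})" by (auto simp: X)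
  have "closed X"
    unfolding X' by (intro closed_INT ballI closed_Collect_le continuous_intros)
  then have [measurable]: "X \<in> sets borel" by simp
  have aeX: "AE x in P. x \<in> X"
    unfolding P_def
    by (subst AE_bind[where B = borel])
      (use OutX Out sr in \<open>auto simp: measurable_cong_sets[OF sr refl] intro: measurable_prob_algebraD\<close>)
  have fX: "\<bar>f x\<bar> \<le> a * r * real DIM('a)" if "x \<in> X" for x
  proof -
    have "\<bar>f x\<bar> \<le> (\<Sum>b\<in>Basis. \<bar>a * spin (b \<in> V) * (x \<bullet> b)\<bar>)" unfolding f by (rule sum_abs)
    also have "\<dots> \<le> (\<Sum>b\<in>(Basis :: 'a set). a * r)"
      using that a by (intro sum_mono) (auto simp: X abs_mult spin_def intro!: mult_left_mono)
    finally show ?thesis by (simp add: mult_ac)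
  qed
  have Inf: "Inf (f ` X) \<le> - (a * r * real DIM('a))"
  proof -
    \<comment> \<open>The corner of the cube opposite to the gradient, where the linear function is
      smallest.\<close>
    define x0 :: 'a where "x0 = (\<Sum>b\<in>Basis. (- r * spin (b \<in> V)) *\<^sub>R b)"
    have x0: "x0 \<bullet> b = - r * spin (b \<in> V)" if "b \<in> Basis" for b
      unfolding x0_def by (rule inner_sum_left_Basis[OF that])
    have "x0 \<in> X" using x0 r by (auto simp: X abs_mult spin_def)
    moreover have "bdd_below (f ` X)"
      using fX by (intro bdd_belowI[of _ "- (a * r * real DIM('a))"]) (fastforce simp: abs_le_iff)
    ultimately have "Inf (f ` X) \<le> f x0" by (intro cInf_lower) auto
    also have "f x0 = (\<Sum>b\<in>(Basis :: 'a set). - (a * r))"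
      unfolding f by (rule sum.cong) (auto simp: x0 spin_def)
    finally show ?thesis by (simp add: mult_ac)
  qed
  \<comment> \<open>A minorant of the excess error on the cube that is bounded and nonnegative
    everywhere, so its integral can be computed as a real number.\<close>
  define G where "G x = (\<Sum>b\<in>Basis. a * r * (1 + spin (b \<in> V) * clip (x \<bullet> b / r)))" for x :: 'a
  have clip: "\<bar>clip y\<bar> \<le> 1" for y by (auto simp: clip_def)
  have G0: "0 \<le> G x" for x
    unfolding G_def using a r clip
    by (intro sum_nonneg mult_nonneg_nonneg) (auto simp: spin_def abs_le_iff clip_def)
  have fG: "G x \<le> f x - Inf (f ` X)" if "x \<in> X" for x
  proof -
    have "G x = (\<Sum>b\<in>Basis. a * r + a * spin (b \<in> V) * (x \<bullet> b))"
      unfolding G_def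
    proof (rule sum.cong[OF refl])
      fix b :: 'a assume "b \<in> Basis"
      then have "\<bar>x \<bullet> b / r\<bar> \<le> 1" using that r by (auto simp: X)
      then have "clip (x \<bullet> b / r) = x \<bullet> b / r" by (rule clip_eq)
      then show "a * r * (1 + spin (b \<in> V) * clip (x \<bullet> b / r)) = a * r + a * spin (b \<in> V) * (x \<bullet> b)"
        using r by (simp add: field_simps)
    qed
    also have "\<dots> = a * r * real DIM('a) + f x" by (simp add: sum.distrib f)
    finally show ?thesis using Inf by simp
  qed
  have cm: "(\<lambda>x. clip (x \<bullet> b / r)) \<in> borel_measurable borel" for b :: 'a
    unfolding clip_def by measurable
  have ci: "integrable P (\<lambda>x. clip (x \<bullet> b / r))" for b :: 'a
    by (rule integrable_prob_algebra_bounded[OF P cm clip])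
  have Gi: "integrable P G"
    unfolding G_def using ci by auto
  have "(\<integral>x. G x \<partial>P) = (\<Sum>b\<in>Basis. a * r * (1 + spin (b \<in> V) * (\<integral>x. clip (x \<bullet> b / r) \<partial>P)))"
    unfolding G_def using ci by (simp add: P.prob_space)
  also have "\<dots> = a * r * (real DIM('a) + (\<Sum>b\<in>Basis. spin (b \<in> V) * (\<integral>x. clip (x \<bullet> b / r) \<partial>P)))"
    by (simp add: sum.distrib flip: sum_distrib_left)
  also have "\<dots> \<ge> a * r * (real DIM('a) / 2)"
    using V a r unfolding P_def[symmetric] by (intro mult_left_mono) auto
  finally have "ennreal (a * r * real DIM('a) / 2) \<le> ennreal (\<integral>x. G x \<partial>P)"
    by (intro ennreal_leI) simp
  also have "\<dots> = (\<integral>\<^sup>+x. ennreal (G x) \<partial>P)"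
    using Gi G0 by (intro nn_integral_eq_integral[symmetric]) auto
  also have "\<dots> \<le> (\<integral>\<^sup>+x. ennreal (f x - Inf (f ` X)) \<partial>P)"
    using aeX by (intro nn_integral_mono_AE) (auto elim!: eventually_mono intro!: ennreal_leI fG)
  finally show ?thesis unfolding opt_error_def P_def f_def .
qed

text \<open>The main diagonal of the cube has norm
  \<open>real DIM('a) powr (1 / p) * (2 * r)\<close>, which this \<open>r\<close> makes equal to
  \<open>D\<close>.\<close>

lemma cube_in_Xsets:
  fixes D :: real
  assumes p: "1 \<le> p" and D: "0 < D"
  defines "r \<equiv> D / 2 * real DIM('a::euclidean_space) powr (- (1 / p))"
  shows "{x :: 'a. \<forall>b\<in>Basis. \<bar>x \<bullet> b\<bar> \<le> r} \<in> Xsets p D"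
proof -
  have r: "0 \<le> r" using D by (simp add: r_def)
  have "lpnorm (ereal p) (x - y) \<le> D" if "\<forall>b\<in>Basis. \<bar>x \<bullet> b\<bar> \<le> r" "\<forall>b\<in>Basis. \<bar>y \<bullet> b\<bar> \<le> r" for x y :: 'a
  proof -
    have "\<bar>(x - y) \<bullet> b\<bar> \<le> 2 * r" if "b \<in> Basis" for b
      using bspec[OF \<open>\<forall>b\<in>Basis. \<bar>x \<bullet> b\<bar> \<le> r\<close> that] bspec[OF \<open>\<forall>b\<in>Basis. \<bar>y \<bullet> b\<bar> \<le> r\<close> that]
      by (simp add: inner_diff_left abs_le_iff)
    then have "lpnorm (ereal p) (x - y) \<le> real DIM('a) powr (1 / p) * (2 * r)"
      using p r by (intro lpnorm_le) auto
    also have "\<dots> = D" by (simp add: r_def powr_minus field_simps)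
    finally show ?thesis .
  qed
  moreover have "(0 :: 'a) \<in> {x. \<forall>b\<in>Basis. \<bar>x \<bullet> b\<bar> \<le> r}" using r by simp
  ultimately show ?thesis unfolding Xsets_def by blast
qed

theorem theorem1:
  fixes p \<epsilon> D B :: real and T :: nat
  assumes "1 \<le> p" "p < 2" "0 \<le> \<epsilon>" "\<epsilon> \<le> 1" "D > 0" "B > 0"
    and "real T \<ge> (1 / (2 * exp 1 * (exp 1 - 1)\<^sup>2)) * (real DIM('a::euclidean_space) / \<epsilon>\<^sup>2)"
  shows "(SUP X \<in> (Xsets p D :: 'a set set). minmax_err p B \<epsilon> X T)
    \<ge> ennreal ((1 / (36 * (exp 1 - 1) * sqrt (2 * exp 1))) * D * B / sqrt (real T)
                * sqrt (real DIM('a) / \<epsilon>\<^sup>2))"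
\<comment> \<open>For \<open>\<epsilon> = 0\<close> division by zero yields 0, so the claimed bound
  is 0.\<close>
proof (cases "\<epsilon> = 0")
  case True
  then show ?thesis by simp
next
  case False
  then have \<epsilon>: "0 < \<epsilon>" "\<epsilon> \<le> 1" using assms by auto
  define d where "d = real DIM('a)"
  have d: "1 \<le> d" using DIM_positive[where 'a = 'a] by (simp add: d_def Suc_le_eq)
  define E where "E = exp (1 :: real)"
  have "exp (ln 2) < exp (1 :: real)" by (subst exp_less_cancel_iff) (rule ln_2_less_1)
  then have E: "2 < E" by (simp add: E_def)
  define c where "c = 1 / (2 * E * (E - 1)\<^sup>2)"
  have c: "0 < c" using E by (simp add: c_def)
  \<comment> \<open>The assumption on \<open>T\<close> makes the root at most 1. The divisor 9 keeps
    the information below \<open>d / 4\<close> and, with the final bound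
    \<open>\<theta> * (D * B) / 4\<close>, produces the constant 36.\<close>
  define \<theta> where "\<theta> = sqrt (c * (d / \<epsilon>\<^sup>2) / real T) / 9"
  have T_ge: "c * (d / \<epsilon>\<^sup>2) \<le> real T" using assms(7) by (simp add: c_def E_def d_def)
  have pos: "0 < c * (d / \<epsilon>\<^sup>2)" using c d \<epsilon> by simp
  then have T: "0 < real T" using T_ge by linarith
  have \<theta>_sq: "\<theta>\<^sup>2 = c * (d / \<epsilon>\<^sup>2) / real T / 81"
    using divide_nonneg_nonneg[OF less_imp_le[OF pos] less_imp_le[OF T]]
    by (simp only: \<theta>_def power_divide real_sqrt_pow2) simp
  have "sqrt (c * (d / \<epsilon>\<^sup>2) / real T) \<le> 1"
    unfolding real_sqrt_le_1_iff pos_divide_le_eq[OF T] using T_ge by (simp only: mult_1_left)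
  moreover have "0 < sqrt (c * (d / \<epsilon>\<^sup>2) / real T)"
    unfolding real_sqrt_gt_0_iff by (rule divide_pos_pos[OF pos T])
  ultimately have \<theta>: "0 < \<theta>" "\<theta> \<le> 1 / 9" by (simp_all only: \<theta>_def)
  have K: "real T * (4 * \<theta>\<^sup>2 / (1 - \<theta>\<^sup>2) * (exp \<epsilon> - 1)\<^sup>2) \<le> d / 4"
  proof -
    have "\<theta>\<^sup>2 \<le> (1 / 9)\<^sup>2" using \<theta> by (intro power_mono) auto
    then have half: "1 / 2 \<le> 1 - \<theta>\<^sup>2" by (simp add: power2_eq_square)
    have "4 * \<theta>\<^sup>2 / (1 - \<theta>\<^sup>2) \<le> 4 * \<theta>\<^sup>2 / (1 / 2)"
      using half by (intro divide_left_mono) auto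
    moreover have "(exp \<epsilon> - 1)\<^sup>2 \<le> ((E - 1) * \<epsilon>)\<^sup>2"
      using exp_minus_one_le[of \<epsilon>] \<epsilon> by (intro power_mono) (auto simp: E_def)
    ultimately have "4 * \<theta>\<^sup>2 / (1 - \<theta>\<^sup>2) * (exp \<epsilon> - 1)\<^sup>2 \<le> 4 * \<theta>\<^sup>2 / (1 / 2) * ((E - 1) * \<epsilon>)\<^sup>2"
      by (intro mult_mono) auto
    then have "real T * (4 * \<theta>\<^sup>2 / (1 - \<theta>\<^sup>2) * (exp \<epsilon> - 1)\<^sup>2) \<le> real T * (8 * \<theta>\<^sup>2 * ((E - 1) * \<epsilon>)\<^sup>2)"
      using T by (intro mult_left_mono) auto
    \<comment> \<open>The choice of \<open>\<theta>\<close> cancels both \<open>T\<close> and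
      \<open>\<epsilon>\<close>.\<close>
    also have "\<dots> = 8 / 81 * (c * (E - 1)\<^sup>2) * d"
      using T \<epsilon> by (simp add: \<theta>_sq power_mult_distrib)
    also have "c * (E - 1)\<^sup>2 = 1 / (2 * E)" using E by (simp add: c_def)
    also have "8 / 81 * (1 / (2 * E)) * d \<le> 1 / 4 * d"
      using E d by (intro mult_right_mono) (auto simp: field_simps)
    finally show ?thesis by simp
  qed
  define r where "r = D / 2 * d powr (- (1 / p))"
  define \<beta> where "\<beta> = B * d powr (1 / p - 1)"
  define X :: "'a set" where "X = {x. \<forall>b\<in>Basis. \<bar>x \<bullet> b\<bar> \<le> r}"
  have r: "0 < r" using assms d by (simp add: r_def)
  have \<beta>: "0 \<le> \<beta>" using assms by (simp add: \<beta>_def)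
  have X: "X \<in> Xsets p D"
    unfolding X_def r_def d_def by (rule cube_in_Xsets) (use assms in auto)
  have "convex X"
    unfolding X_def
  proof (rule convexI, safe)
    fix x y b :: 'a and u v :: real
    assume xy: "\<forall>b\<in>Basis. \<bar>x \<bullet> b\<bar> \<le> r" "\<forall>b\<in>Basis. \<bar>y \<bullet> b\<bar> \<le> r" and b: "b \<in> Basis"
      and uv: "0 \<le> u" "0 \<le> v" "u + v = 1"
    have "\<bar>u * (x \<bullet> b) + v * (y \<bullet> b)\<bar> \<le> r"
      unfolding abs_le_iff minus_add_distrib mult_minus_right[symmetric]
      using xy b uv by (intro conjI convex_bound_le) (auto simp: abs_le_iff)
    then show "\<bar>(u *\<^sub>R x + v *\<^sub>R y) \<bullet> b\<bar> \<le> r" by (simp add: inner_add_left)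
  qed
  \<comment> \<open>The exponents add up to 0, so neither \<open>p\<close> nor the dimension
    survives.\<close>
  have "r * \<beta> * d = D * B / 2 * (d powr (- (1 / p)) * d powr (1 / p - 1) * d powr 1)"
    using d by (simp add: r_def \<beta>_def)
  also have "\<dots> = D * B / 2" using d by (simp add: powr_add[symmetric])
  finally have r\<beta>: "r * \<beta> * d = D * B / 2" .
  have constant_eq: "(1 / (36 * (exp 1 - 1) * sqrt (2 * exp 1))) * D * B / sqrt (real T) * sqrt (d / \<epsilon>\<^sup>2)
      = \<theta> * \<beta> * r * d / 2"
  proof -
    have "sqrt c = 1 / (sqrt (2 * E) * (E - 1))"
      using E by (simp add: c_def real_sqrt_divide real_sqrt_mult)
    then have "\<theta> = 1 / (sqrt (2 * E) * (E - 1)) * sqrt (d / \<epsilon>\<^sup>2) / sqrt (real T) / 9"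
      unfolding \<theta>_def by (simp only: real_sqrt_divide[of _ "real T"] real_sqrt_mult[of c])
    moreover have "\<theta> * \<beta> * r * d / 2 = \<theta> * (D * B) / 4"
      using r\<beta> by (simp add: mult_ac)
    ultimately show ?thesis by (simp add: E_def mult_ac)
  qed
  have "ennreal (\<theta> * \<beta> * r * d / 2) \<le> minmax_err p B \<epsilon> X T"
    unfolding minmax_err_def
  proof (rule INF_greatest, rule INF_greatest)
    fix QO and S :: "nat \<Rightarrow> (nat \<Rightarrow> 'a) \<Rightarrow> 'a \<Rightarrow> 'a measure"
    assume QO: "QO \<in> valid_alg X" and S: "S \<in> valid_strategy \<epsilon>"
    obtain Q Out where [simp]: "QO = (Q, Out)" by (cases QO)
    have Q: "\<And>t. Q t \<in> HM \<rightarrow>\<^sub>M prob_algebra borel" and Out: "Out \<in> HM \<rightarrow>\<^sub>M prob_algebra borel"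
      using QO by (auto simp: valid_alg_def)
    \<comment> \<open>The pattern may depend on the algorithm and the strategy, because the supremum
      over instances stands inside both infima.\<close>
    obtain V :: "'a set" where V: "- (real DIM('a) / 2) \<le> (\<Sum>b\<in>Basis. spin (b \<in> V) *
        (\<integral>x. clip (x \<bullet> b / r) \<partial>(run Q S (\<lambda>_. sign_oracle \<beta> \<theta> V) T \<bind> Out)))"
      using exists_unlearned_sign_pattern[where Q = Q and \<theta> = \<theta> and T = T and r = r and \<beta> = \<beta>, OF Q Out S] \<theta> K unfolding d_def by auto
    have "ennreal (\<theta> * \<beta> * r * d / 2)
        \<le> opt_error (\<lambda>x. (\<Sum>b\<in>Basis. (\<theta> * \<beta> * spin (b \<in> V)) *\<^sub>R b) \<bullet> x) X (\<lambda>_. sign_oracle \<beta> \<theta> V) Q Out S T"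
      unfolding d_def
      by (rule opt_error_lower_bound[OF _ S _ r _ X_def V]) (use QO \<theta> \<beta> in auto)
    moreover have "(\<lambda>x. (\<Sum>b\<in>Basis. (\<theta> * \<beta> * spin (b \<in> V)) *\<^sub>R b) \<bullet> x, \<lambda>_. sign_oracle \<beta> \<theta> V) \<in> oracle_class p B X"
      unfolding \<beta>_def d_def using assms \<theta> by (intro sign_oracle_in_oracle_class \<open>convex X\<close>) auto
    ultimately show "ennreal (\<theta> * \<beta> * r * d / 2)
        \<le> (SUP fO\<in>oracle_class p B X. opt_error (fst fO) X (snd fO) (fst QO) (snd QO) S T)"
      by (intro SUP_upper2) auto
  qed
  also have "\<dots> \<le> (SUP X \<in> (Xsets p D :: 'a set set). minmax_err p B \<epsilon> X T)"
    by (rule SUP_upper[OF X])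
  finally show ?thesis unfolding d_def[symmetric] constant_eq .
qed

end
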